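(* Let $1\le k\le n/2$. Let $Q_0,Q_1\in\mathrm{Gr}(k,n)$ with eigendecompositions $Q_0=V_0I_{k,n-k}V_0^{\mathsf T}$ and $Q_1=V_1I_{k,n-k}V_1^{\mathsf T}$, $V_0,V_1\in\mathrm{O}(n)$. Let a CS decomposition of $V_0^{\mathsf T}V_1\in\mathrm{O}(n)$ be \[ V_0^{\mathsf T}V_1=\begin{bmatrix}U & 0 \\ 0 & V\end{bmatrix}\begin{bmatrix}\cos\Theta & \sin\Theta & 0 \\ -\sin\Theta & \cos\Theta & 0 \\ 0 & 0 & I_{n-2k}\end{bmatrix}\begin{bmatrix}W & 0 \\ 0 & Z\end{bmatrix}^{\mathsf T}, \] where $U,W\in\mathrm{O}(k)$, $V,Z\in\mathrm{O}(n-k)$, $\Theta=\operatorname{diag}(\theta_1,\dots,\theta_k)\in\mathbb{R}^{k\times k}$ with $\theta_i\in[0,\pi/2]$ for $i=1,\dots,k$. Then the curve \[ \gamma(t)=V_0\exp\left(\frac t2\begin{bmatrix}0 & -B \\ B^{\mathsf T} & 0\end{bmatrix}\right)I_{k,n-k}\exp\left(\frac t2\begin{bmatrix}0 & B \\ -B^{\mathsf T} & 0\end{bmatrix}\right)V_0^{\mathsf T},\qquad t\in[0,1], \] where $B=-2U[\Theta,0]V^{\mathsf T}\in\mathbb{R}^{k\times(n-k)}$ with $0\in\mathbb{R}^{k\times(n-2k)}$, is a length-minimizing geodesic in $\mathrm{Gr}(k,n)$ connecting $\gamma(0)=Q_0$ to $\gamma(1)=Q_1$.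
   Context: $\mathrm{Gr}(k,n)=\{Q\in\mathrm{O}(n):Q^{\mathsf T}=Q,\ \operatorname{tr}(Q)=2k-n\}$, an embedded submanifold of $\mathbb{R}^{n\times n}$, equipped with the Riemannian metric $\langle X,Y\rangle_Q=\operatorname{tr}(XY)$ for $X,Y\in\mathbb{T}_Q\mathrm{Gr}(k,n)$ (tangent vectors are symmetric matrices). $I_{k,n-k}=\operatorname{diag}(I_k,-I_{n-k})$. $\cos\Theta$ and $\sin\Theta$ are the diagonal matrices $\operatorname{diag}(\cos\theta_i)$ and $\operatorname{diag}(\sin\theta_i)$. $\exp$ is the matrix exponential. *)

theory Defs
  imports "HOL-Analysis.Analysis"
begin

text \<open>
  An \<open>n \<times> n\<close> matrix partitioned according to \<open>n = k + (n - k)\<close> is indexed by a sum type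
  \<open>'k + 'p\<close> with \<open>k = CARD('k)\<close> and \<open>n - k = CARD('p)\<close>.
\<close>

definition block_matrix ::
    "'a^'c1^'r1 \<Rightarrow> 'a^'c2^'r1 \<Rightarrow> 'a^'c1^'r2 \<Rightarrow> 'a^'c2^'r2 \<Rightarrow>
      'a^('c1::finite + 'c2::finite)^('r1::finite + 'r2::finite)" where
  "block_matrix A B C D = (\<chi> i j. case i of
       Inl r \<Rightarrow> (case j of Inl c \<Rightarrow> A $ r $ c | Inr c \<Rightarrow> B $ r $ c)
     | Inr r \<Rightarrow> (case j of Inl c \<Rightarrow> C $ r $ c | Inr c \<Rightarrow> D $ r $ c))"

definition diag_matrix :: "('k \<Rightarrow> real) \<Rightarrow> real^'k^'k::finite" where
  "diag_matrix d = (\<chi> i j. if i = j then d i else 0)"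

definition sig_matrix :: "real^('k::finite + 'p::finite)^('k + 'p)" where
  "sig_matrix = block_matrix (mat 1) 0 0 (- mat 1)"

text \<open>
  The further partition \<open>n - k = k + (n - 2k)\<close> cannot be a sum of types, because a type is never
  empty and \<open>n = 2k\<close> is allowed.  Instead an injection \<open>e :: 'k \<Rightarrow> 'p\<close> says which of the indices
  in \<open>'p\<close> are the first \<open>k\<close> ones and how they are matched with \<open>'k\<close>; the remaining
  \<open>n - 2k\<close> indices are those outside \<open>range e\<close>.  Such an injection exists precisely when
  \<open>k \<le> n - k\<close>, that is \<open>k \<le> n / 2\<close>.  With respect to this partition,
  \<open>hpad e A\<close> is \<open>[A, 0]\<close>, \<open>vpad e A\<close> is \<open>A\<close> on top of a zero block, and \<open>dpad e A\<close> is
  \<open>diag(A, I)\<close> with \<open>I\<close> of size \<open>n - 2k\<close>.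
\<close>

definition hpad :: "('k \<Rightarrow> 'p) \<Rightarrow> real^'k^'r \<Rightarrow> real^'p::finite^'r::finite" where
  "hpad e A = (\<chi> i j. if j \<in> range e then A $ i $ inv e j else 0)"

definition vpad :: "('k \<Rightarrow> 'p) \<Rightarrow> real^'c^'k \<Rightarrow> real^'c::finite^'p::finite" where
  "vpad e A = (\<chi> i j. if i \<in> range e then A $ inv e i $ j else 0)"

definition dpad :: "('k \<Rightarrow> 'p) \<Rightarrow> real^'k^'k \<Rightarrow> real^'p::finite^'p" where
  "dpad e A = (\<chi> i j. if i \<in> range e \<and> j \<in> range e then A $ inv e i $ inv e j
                       else if i = j then 1 else 0)"

text \<open>
  The constant \<open>exp\<close> and the power operation of the library are not available for \<open>real^'n^'n\<close>,
  whose multiplication \<open>(*)\<close> is the componentwise one.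
\<close>

primrec matrix_pow :: "real^'n^'n::finite \<Rightarrow> nat \<Rightarrow> real^'n^'n" where
  "matrix_pow A 0 = mat 1"
| "matrix_pow A (Suc m) = A ** matrix_pow A m"

definition matrix_exp :: "real^'n^'n::finite \<Rightarrow> real^'n^'n" where
  "matrix_exp A = (\<Sum>m. (1 / fact m) *\<^sub>R matrix_pow A m)"

text \<open>
  \<open>jet_on I D\<close>: the curve \<open>D 0\<close> is infinitely differentiable on \<open>I\<close>, with \<open>m\<close>-th derivative
  \<open>D m\<close> (one-sided at an end point belonging to \<open>I\<close>).
\<close>

definition jet_on :: "real set \<Rightarrow> (nat \<Rightarrow> real \<Rightarrow> 'a::real_normed_vector) \<Rightarrow> bool" where
  "jet_on I D \<longleftrightarrow> (\<forall>m. \<forall>t\<in>I. (D m has_vector_derivative D (Suc m) t) (at t within I))"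

definition tangent_space :: "'a::real_normed_vector set \<Rightarrow> 'a \<Rightarrow> 'a set" where
  "tangent_space M x =
     {D 1 0 | D \<epsilon>. \<epsilon> > 0 \<and> jet_on {-\<epsilon><..<\<epsilon>} D \<and> (\<forall>t\<in>{-\<epsilon><..<\<epsilon>}. D 0 t \<in> M) \<and> D 0 0 = x}"

text \<open>
  For the metric induced by the ambient inner product, the covariant derivative of the velocity
  of a curve in \<open>M\<close> is the orthogonal projection of its second derivative onto the tangent space.
  A geodesic is a smooth curve for which it vanishes identically.
\<close>

definition geodesic_on :: "'a::euclidean_space set \<Rightarrow> real \<Rightarrow> real \<Rightarrow> (real \<Rightarrow> 'a) \<Rightarrow> bool" where
  "geodesic_on M a b c \<longleftrightarrow> c ` {a..b} \<subseteq> M \<and>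
     (\<exists>D. D 0 = c \<and> jet_on {a..b} D \<and>
       (\<forall>t\<in>{a..b}. \<forall>v\<in>tangent_space M (c t). D 2 t \<bullet> v = 0))"

text \<open>
  A Riemannian metric is given as a function \<open>g\<close> of the base point and two tangent vectors.  The
  length is a nonnegative Lebesgue integral, so it is infinite (and not \<open>0\<close>) if the speed is not
  integrable, which can happen for the curves admitted by \<^const>\<open>piecewise_C1_differentiable_on\<close>:
  their derivatives may be unbounded near an exceptional point.
\<close>

definition curve_length ::
    "('a::real_normed_vector \<Rightarrow> 'a \<Rightarrow> 'a \<Rightarrow> real) \<Rightarrow> real \<Rightarrow> real \<Rightarrow> (real \<Rightarrow> 'a) \<Rightarrow> ennreal" where
  "curve_length g a b c =
     (\<integral>\<^sup>+t\<in>{a..b}. ennreal (let v = vector_derivative c (at t within {a..b})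
                          in sqrt (g (c t) v v)) \<partial>lborel)"

definition length_minimizing_on ::
    "'a::real_normed_vector set \<Rightarrow> ('a \<Rightarrow> 'a \<Rightarrow> 'a \<Rightarrow> real) \<Rightarrow> real \<Rightarrow> real \<Rightarrow> (real \<Rightarrow> 'a) \<Rightarrow> bool"
  where
  "length_minimizing_on M g a b c \<longleftrightarrow>
     c piecewise_C1_differentiable_on {a..b} \<and> c ` {a..b} \<subseteq> M \<and>
     (\<forall>a' b' d. a' < b' \<and> d piecewise_C1_differentiable_on {a'..b'} \<and> d ` {a'..b'} \<subseteq> M \<and>
        d a' = c a \<and> d b' = c b \<longrightarrow> curve_length g a b c \<le> curve_length g a' b' d)"

definition Gr :: "nat \<Rightarrow> (real^'n^'n::finite) set" where
  "Gr k = {Q. orthogonal_matrix Q \<and> transpose Q = Q \<and> trace Q = 2 * real k - real CARD('n)}"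

definition Gr_metric :: "real^'n^'n::finite \<Rightarrow> real^'n^'n \<Rightarrow> real^'n^'n \<Rightarrow> real" where
  "Gr_metric Q X Y = trace (X ** Y)"

text \<open>
  The metric is the one induced by the ambient inner product, as
  \<^const>\<open>geodesic_on\<close> presupposes.
\<close>

lemma tangent_space_Gr_symmetric:
  assumes "X \<in> tangent_space (Gr k) Q"
  shows "transpose X = X"
proof -
  from assms obtain D \<epsilon> where e: "\<epsilon> > 0" and D: "jet_on {-\<epsilon><..<\<epsilon>} D"
    and M: "\<forall>t\<in>{-\<epsilon><..<\<epsilon>}. D 0 t \<in> Gr k" and X: "X = D 1 0"
    unfolding tangent_space_def by blast
  have d: "(D 0 has_vector_derivative X) (at 0 within {-\<epsilon><..<\<epsilon>})"
    using D e X unfolding jet_on_def by auto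
  then have "((\<lambda>t. transpose (D 0 t)) has_vector_derivative transpose X) (at 0 within {-\<epsilon><..<\<epsilon>})"
  proof (rule bounded_linear.has_vector_derivative[rotated])
    have "linear (transpose :: real^'n^'n \<Rightarrow> real^'n^'n)"
      by (rule linearI) (simp_all add: transpose_def vec_eq_iff)
    then show "bounded_linear (transpose :: real^'n^'n \<Rightarrow> real^'n^'n)"
      by (simp add: linear_conv_bounded_linear)
  qed
  then have "(D 0 has_vector_derivative transpose X) (at 0 within {-\<epsilon><..<\<epsilon>})"
    by (rule has_vector_derivative_transform[rotated 2]) (use M e in \<open>auto simp: Gr_def\<close>)
  with d show ?thesis
    using e by (metis at_within_open greaterThanLessThan_iff neg_less_0_iff_less
        open_greaterThanLessThan vector_derivative_unique_at)
qed

lemma Gr_metric_induced: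
  assumes "X \<in> tangent_space (Gr k) Q" "Y \<in> tangent_space (Gr k) Q"
  shows "Gr_metric Q X Y = X \<bullet> Y"
proof -
  have "Y $ j $ i = Y $ i $ j" for i j
    using tangent_space_Gr_symmetric[OF assms(2)] by (metis transpose_def vec_lambda_beta)
  then have "(\<Sum>i\<in>UNIV. \<Sum>j\<in>UNIV. X $ i $ j * Y $ j $ i) =
      (\<Sum>i\<in>UNIV. \<Sum>j\<in>UNIV. X $ i $ j * Y $ i $ j)"
    by (intro sum.cong refl) (metis (no_types))
  then show ?thesis
    by (simp add: Gr_metric_def trace_def matrix_matrix_mult_def inner_vec_def)
qed

end

theory Submission
  imports Defs
begin

text \<open>
  In the basis \<open>N = V\<^sub>0 diag(U, V)\<close> the matrix exponential is a product of plane rotations by the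
  angles \<open>t \<theta>\<^sub>i\<close>, so \<open>\<gamma>\<close> solves the linear equation \<open>\<gamma>' = 2 \<Omega> \<gamma>\<close> with \<open>\<Omega>\<close> anticommuting with \<open>\<gamma>\<close>;
  its second derivative commutes with \<open>\<gamma>\<close> and is therefore normal to the Grassmannian.

  For minimality, project the first \<open>k\<close> columns of \<open>N\<close> successively onto the \<open>+1\<close> eigenspaces of
  \<open>d(t\<^sub>0), d(t\<^sub>1), \<dots>\<close> along a competing curve \<open>d\<close>.  Each step moves the vectors, jointly, by at most
  \<open>\<parallel>d(t\<^sub>j\<^sub>+\<^sub>1) - d(t\<^sub>j)\<parallel> / \<surd>8\<close>, and their norms tend to \<open>1\<close> as the mesh tends to \<open>0\<close>; this is a discrete
  substitute for the horizontal lift of \<open>d\<close>.  The \<open>i\<close>-th vector ends in the \<open>+1\<close> eigenspace of \<open>Q\<^sub>1\<close>,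
  whose angle with the \<open>i\<close>-th column is \<open>\<theta>\<^sub>i\<close>, so it has travelled at least \<open>\<theta>\<^sub>i\<close>.
\<close>

subsection \<open>Angles along polygons\<close>

text \<open>Triangle inequality for the angular distance on the unit sphere. The components
  \<open>p\<close> and \<open>q\<close> of \<open>x\<close> and \<open>z\<close> orthogonal to
  \<open>y\<close> have norms \<open>sin a\<close> and \<open>sin b\<close>, so Cauchy-Schwarz for
  \<open>p\<close> and \<open>q\<close> is exactly the addition formula for
  \<open>cos (a + b)\<close>. For \<open>a + b > pi\<close> the bound is trivial.\<close>

lemma arccos_inner_triangle:
  fixes x y z :: "'a::real_inner"
  assumes x: "norm x = 1" and y: "norm y = 1" and z: "norm z = 1"
  shows "arccos (x \<bullet> z) \<le> arccos (x \<bullet> y) + arccos (y \<bullet> z)"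
proof -
  define a b where "a = arccos (x \<bullet> y)" and "b = arccos (y \<bullet> z)"
  have bd: "\<bar>u \<bullet> v\<bar> \<le> 1" if "norm u = 1" "norm v = 1" for u v :: 'a
    using Cauchy_Schwarz_ineq2[of u v] that by simp
  note bxy = bd[OF x y] and byz = bd[OF y z] and bxz = bd[OF x z]
  have a: "cos a = x \<bullet> y" "0 \<le> a" "a \<le> pi" and b: "cos b = y \<bullet> z" "0 \<le> b" "b \<le> pi"
    using bxy byz by (auto simp: a_def b_def intro!: arccos_lbound arccos_ubound)
  have xx: "x \<bullet> x = 1" "y \<bullet> y = 1" "z \<bullet> z = 1"
    using x y z by (simp_all add: norm_eq_1)
  define p q where "p = x - (x \<bullet> y) *\<^sub>R y" and "q = z - (y \<bullet> z) *\<^sub>R y"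
  have "p \<bullet> p = 1 - (x \<bullet> y)\<^sup>2" "q \<bullet> q = 1 - (y \<bullet> z)\<^sup>2"
    by (simp_all add: p_def q_def inner_diff_left inner_diff_right xx inner_commute power2_eq_square)
  then have "norm p = sin a" "norm q = sin b"
    using bxy byz by (simp_all add: a_def b_def sin_arccos_abs norm_eq_sqrt_inner)
  moreover have "p \<bullet> q = x \<bullet> z - cos a * cos b"
    by (simp add: p_def q_def inner_diff_left inner_diff_right xx a b inner_commute)
  ultimately have *: "cos (a + b) \<le> x \<bullet> z"
    using Cauchy_Schwarz_ineq2[of p q] by (simp add: cos_add)
  show ?thesis
  proof (cases "a + b \<le> pi")
    case True
    have "arccos (x \<bullet> z) \<le> arccos (cos (a + b))"
      using * bxz by (intro arccos_le_arccos) auto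
    with True a b show ?thesis by (simp add: arccos_cos a_def b_def)
  next
    case False
    with bxz show ?thesis
      using arccos_ubound[of "x \<bullet> z"] unfolding a_def b_def by linarith
  qed
qed

text \<open>The points 0, \<open>z\<close>, \<open>y\<close> form a triangle with a right angle at
  \<open>z\<close>. Its angle at 0 has tangent \<open>u\<close>, the ratio of the legs, and
  \<open>arctan u \<le> u\<close>.\<close>

lemma arccos_orthogonal_step:
  fixes y z :: "'a::real_inner"
  assumes orth: "z \<bullet> (z - y) = 0" and z: "z \<noteq> 0"
  shows "arccos (sgn y \<bullet> sgn z) \<le> norm (z - y) / norm z"
proof -
  define u where "u = norm (z - y) / norm z"
  have zz: "z \<bullet> y = (norm z)\<^sup>2"
    using orth by (simp add: inner_diff_right power2_norm_eq_inner)
  have yy: "(norm y)\<^sup>2 = (norm z)\<^sup>2 + (norm (z - y))\<^sup>2"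
    using zz by (simp add: power2_norm_eq_inner inner_diff_left inner_diff_right inner_commute)
  have "(norm z)\<^sup>2 * (1 + u\<^sup>2) = (norm y)\<^sup>2"
    using z yy by (simp add: u_def field_simps)
  then have "norm y = norm z * sqrt (1 + u\<^sup>2)"
    by (metis norm_ge_zero power2_norm_eq_inner real_sqrt_mult real_sqrt_unique)
  then have "norm z / norm y = 1 / sqrt (1 + u\<^sup>2)"
    using z by simp
  also have "\<dots> = cos (arctan u)"
    by (simp add: cos_arctan)
  finally have "sgn y \<bullet> sgn z = cos (arctan u)"
    using zz z by (simp add: sgn_div_norm inner_commute power2_eq_square divide_simps)
  moreover have "0 \<le> u" by (simp add: u_def)
  moreover from this have "arccos (cos (arctan u)) = arctan u"
    using arctan_ubound[of u] pi_gt_zero zero_le_arctan_iff[of u] by (intro arccos_cos) linarith+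
  ultimately show ?thesis
    using arctan_le_self[of u] by (simp flip: u_def)
qed

text \<open>Each vertex is the foot of a perpendicular from its predecessor, so the two preceding
  bounds add up. The lower bound \<open>r\<close> on the norms converts Euclidean steps into
  angles.\<close>

lemma angle_le_polygon:
  fixes y :: "nat \<Rightarrow> 'a::real_inner"
  assumes orth: "\<And>j. j < N \<Longrightarrow> y (Suc j) \<bullet> (y (Suc j) - y j) = 0"
    and r: "0 < r" and y: "\<And>j. j \<le> N \<Longrightarrow> r \<le> norm (y j)"
  shows "arccos (sgn (y 0) \<bullet> sgn (y N)) \<le> (\<Sum>j<N. norm (y (Suc j) - y j)) / r"
  using orth y
proof (induction N)
  case 0
  then have "norm (sgn (y 0)) = 1"
    using r by (auto simp: norm_sgn)
  then show ?case by (simp add: norm_eq_1)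
next
  case (Suc N)
  have nz: "y 0 \<noteq> 0" "y N \<noteq> 0" "y (Suc N) \<noteq> 0"
    using r Suc.prems(2)[of 0] Suc.prems(2)[of N] Suc.prems(2)[of "Suc N"] by auto
  have "arccos (sgn (y 0) \<bullet> sgn (y (Suc N))) \<le>
      arccos (sgn (y 0) \<bullet> sgn (y N)) + arccos (sgn (y N) \<bullet> sgn (y (Suc N)))"
    using nz by (intro arccos_inner_triangle) (auto simp: norm_sgn)
  also have "\<dots> \<le> (\<Sum>j<N. norm (y (Suc j) - y j)) / r + norm (y (Suc N) - y N) / norm (y (Suc N))"
    using Suc nz by (intro add_mono arccos_orthogonal_step) auto
  also have "\<dots> \<le> (\<Sum>j<N. norm (y (Suc j) - y j)) / r + norm (y (Suc N) - y N) / r"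
    using r Suc.prems(2)[of "Suc N"]
    by (intro add_left_mono divide_left_mono) (auto intro!: mult_pos_pos)
  finally show ?case by (simp add: add_divide_distrib)
qed

subsection \<open>Projections onto eigenspaces\<close>

lemma inner_matrix_eq_trace: "(X :: real^'n^'m) \<bullet> Y = trace (transpose X ** Y)"
proof -
  have "trace (transpose X ** Y) = (\<Sum>i\<in>UNIV. \<Sum>j\<in>UNIV. X $ j $ i * Y $ j $ i)"
    by (simp add: trace_def matrix_matrix_mult_def transpose_def)
  also have "\<dots> = X \<bullet> Y"
    by (subst sum.swap) (simp add: inner_vec_def)
  finally show ?thesis ..
qed

lemma linear_matrix_mul_left: "linear (\<lambda>X. (A::real^'n^'m) ** (X::real^'k^'n))"
  by (rule linearI) (simp_all add: matrix_matrix_mult_def vec_eq_iff sum.distrib distrib_left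
      sum_distrib_left mult_ac)

lemma linear_matrix_mul_right: "linear (\<lambda>X. (X::real^'n^'m) ** (A::real^'k^'n))"
  by (rule linearI) (simp_all add: matrix_matrix_mult_def vec_eq_iff sum.distrib distrib_right
      sum_distrib_left mult.assoc)

lemmas matrix_mul_linear_simps =
  linear_add[OF linear_matrix_mul_left] linear_add[OF linear_matrix_mul_right]
  linear_diff[OF linear_matrix_mul_left] linear_diff[OF linear_matrix_mul_right]
  linear_neg[OF linear_matrix_mul_left] linear_neg[OF linear_matrix_mul_right]
  linear_cmul[OF linear_matrix_mul_left] linear_cmul[OF linear_matrix_mul_right]

lemma transpose_linear_simps:
  "transpose (A + B) = transpose A + transpose (B::real^'n^'m)"
  "transpose (A - B) = transpose A - transpose (B::real^'n^'m)"
  "transpose (- A) = - transpose (A::real^'n^'m)"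
  "transpose (c *\<^sub>R A) = c *\<^sub>R transpose (A::real^'n^'m)"
  by (simp_all add: transpose_def vec_eq_iff)

lemma trace_scaleR: "trace (c *\<^sub>R A) = c * trace (A::real^'n^'n)"
  by (simp add: trace_def sum_distrib_left)

lemma GrD:
  fixes Q :: "real^'n::finite^'n"
  assumes "Q \<in> Gr k"
  shows "transpose Q = Q" "Q ** Q = mat 1" "trace Q = 2 * real k - real CARD('n)"
  using assms by (auto simp: Gr_def orthogonal_matrix)

text \<open>The matrix is 4 times the projection onto the +1 eigenspace of \<open>Q\<close> followed
  by the projection onto the -1 eigenspace of \<open>Q'\<close>. Both sides equal 4 times the
  dimension minus \<open>trace (Q' ** Q)\<close>; the terms linear in \<open>Q\<close> and
  \<open>Q'\<close> cancel because the two traces agree.\<close>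

lemma norm_Gr_projection_defect:
  fixes Q Q' :: "real^'n::finite^'n"
  assumes Q: "Q \<in> Gr k" and Q': "Q' \<in> Gr k"
  shows "(norm ((mat 1 - Q') ** (mat 1 + Q)))\<^sup>2 = 2 * (norm (Q' - Q))\<^sup>2"
proof -
  note q = GrD[OF Q] and q' = GrD[OF Q']
  have sq: "(mat 1 + Q) ** (mat 1 + Q) = 2 *\<^sub>R (mat 1 + Q)"
    "(mat 1 - Q') ** (mat 1 - Q') = 2 *\<^sub>R (mat 1 - Q')"
    by (simp_all add: matrix_mul_linear_simps q q' scaleR_2)
  have "(norm ((mat 1 - Q') ** (mat 1 + Q)))\<^sup>2 =
      trace ((mat 1 + Q) ** ((mat 1 - Q') ** ((mat 1 - Q') ** (mat 1 + Q))))"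
    by (simp add: power2_norm_eq_inner inner_matrix_eq_trace matrix_transpose_mul
        transpose_linear_simps q q' matrix_mul_assoc)
  \<comment> \<open>Cyclicity of the trace brings equal factors together. Each factor is twice a
    projection, so its square is twice itself.\<close>
  also have "\<dots> = trace ((mat 1 - Q') ** ((mat 1 - Q') ** ((mat 1 + Q) ** (mat 1 + Q))))"
    by (subst trace_mul_sym) (simp only: matrix_mul_assoc)
  also have "\<dots> = trace (4 *\<^sub>R ((mat 1 - Q') ** (mat 1 + Q)))"
    unfolding matrix_mul_assoc[of "mat 1 - Q'" "mat 1 - Q'"] sq
    by (simp add: linear_cmul[OF linear_matrix_mul_left] linear_cmul[OF linear_matrix_mul_right])
  also have "\<dots> = 4 * (real CARD('n) - trace (Q' ** Q))"
    using q(3) q'(3) by (simp add: matrix_mul_linear_simps trace_add trace_sub trace_I trace_scaleR)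
  also have "\<dots> = 2 * (norm (Q' - Q))\<^sup>2"
    using trace_mul_sym[of Q Q']
    unfolding power2_norm_eq_inner inner_diff_left inner_diff_right
    by (simp add: inner_matrix_eq_trace q q' trace_I)
  finally show ?thesis .
qed

text \<open>Projecting an orthonormal frame destroys orthonormality but preserves Bessel's inequality.\<close>

definition bessel :: "('k::finite \<Rightarrow> 'a::real_inner) \<Rightarrow> bool" where
  "bessel y \<longleftrightarrow> (\<forall>x. (\<Sum>i\<in>UNIV. (x \<bullet> y i)\<^sup>2) \<le> (norm x)\<^sup>2)"

text \<open>Bessel's inequality is applied to every row of \<open>M\<close>; the squared norms of
  the rows sum to the squared Frobenius norm.\<close>

lemma bessel_matrix:
  fixes M :: "real^'n::finite^'m::finite" and y :: "'k::finite \<Rightarrow> real^'n"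
  assumes "bessel y"
  shows "(\<Sum>i\<in>UNIV. (norm (M *v y i))\<^sup>2) \<le> (norm M)\<^sup>2"
proof -
  have "(norm (M *v x))\<^sup>2 = (\<Sum>a\<in>UNIV. (M $ a \<bullet> x)\<^sup>2)" for x
    unfolding power2_norm_eq_inner inner_vec_def[of "M *v x"] matrix_vector_mul_component
    by (simp add: power2_eq_square)
  then have "(\<Sum>i\<in>UNIV. (norm (M *v y i))\<^sup>2) = (\<Sum>i\<in>UNIV. \<Sum>a\<in>UNIV. (M $ a \<bullet> y i)\<^sup>2)"
    by simp
  also have "\<dots> = (\<Sum>a\<in>UNIV. \<Sum>i\<in>UNIV. (M $ a \<bullet> y i)\<^sup>2)"
    by (rule sum.swap)
  also have "\<dots> \<le> (\<Sum>a\<in>UNIV. (norm (M $ a))\<^sup>2)"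
    using assms by (intro sum_mono) (auto simp: bessel_def)
  also have "\<dots> = (norm M)\<^sup>2"
    by (simp add: power2_norm_eq_inner inner_vec_def[of M])
  finally show ?thesis .
qed

text \<open>For a symmetric involution \<open>Q\<close> this is the orthogonal projection onto the
  eigenspace for the eigenvalue +1.\<close>

definition eigenproj :: "real^'n^'n \<Rightarrow> real^'n \<Rightarrow> real^'n::finite" where
  "eigenproj Q y = (1 / 2) *\<^sub>R (y + Q *v y)"

lemma eigenproj_fixed: "Q \<in> Gr k \<Longrightarrow> Q *v eigenproj Q y = eigenproj Q y"
  by (simp add: eigenproj_def matrix_vector_mult_scaleR matrix_vector_right_distrib
      matrix_vector_mul_assoc GrD)

lemma Gr_inner_self_adjoint: "Q \<in> Gr k \<Longrightarrow> (Q *v x) \<bullet> y = x \<bullet> (Q *v y)"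
  by (metis GrD(1) dot_lmul_matrix transpose_matrix_vector)

lemma eigenproj_self_adjoint: "Q \<in> Gr k \<Longrightarrow> eigenproj Q x \<bullet> y = x \<bullet> eigenproj Q y"
  by (simp add: eigenproj_def inner_add_left inner_add_right Gr_inner_self_adjoint)

lemma eigenproj_idem: "Q *v y = y \<Longrightarrow> eigenproj Q y = y"
  by (simp add: eigenproj_def flip: scaleR_2)

lemma eigenproj_orth:
  assumes "Q \<in> Gr k" shows "eigenproj Q y \<bullet> (eigenproj Q y - y) = 0"
  using eigenproj_self_adjoint[OF assms, of y "eigenproj Q y"]
    eigenproj_idem[OF eigenproj_fixed[OF assms], of y]
  by (simp add: inner_diff_right inner_commute)

lemma eigenproj_pythagoras:
  assumes "Q \<in> Gr k"
  shows "(norm (eigenproj Q y))\<^sup>2 = (norm y)\<^sup>2 - (norm (eigenproj Q y - y))\<^sup>2"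
  using eigenproj_orth[OF assms, of y]
  by (simp add: power2_norm_eq_inner inner_diff_left inner_diff_right inner_commute)

lemma eigenproj_norm_le: "Q \<in> Gr k \<Longrightarrow> norm (eigenproj Q y) \<le> norm y"
  by (rule power2_le_imp_le) (simp_all add: eigenproj_pythagoras)

text \<open>The projection is self-adjoint, so it can be moved from the frame to the test vector
  \<open>x\<close>, whose norm it does not increase.\<close>

lemma bessel_eigenproj:
  assumes "Q \<in> Gr k" "bessel y" shows "bessel (\<lambda>i. eigenproj Q (y i))"
  unfolding bessel_def
proof
  fix x
  have "(\<Sum>i\<in>UNIV. (x \<bullet> eigenproj Q (y i))\<^sup>2) \<le> (norm (eigenproj Q x))\<^sup>2"
    using assms(2) unfolding bessel_def eigenproj_self_adjoint[OF assms(1), symmetric] by blast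
  also have "\<dots> \<le> (norm x)\<^sup>2"
    by (intro power_mono eigenproj_norm_le[OF assms(1)]) simp
  finally show "(\<Sum>i\<in>UNIV. (x \<bullet> eigenproj Q (y i))\<^sup>2) \<le> (norm x)\<^sup>2" .
qed

text \<open>This is the infinitesimal heart of the lower bound: the joint displacement of the whole
  frame is controlled by one chord. The constant 1/8 is 2/16, with 2 from
  \<open>norm_Gr_projection_defect\<close> and 16 from the square of the factor 1/4 below.\<close>

lemma bessel_step:
  fixes Q Q' :: "real^'n::finite^'n" and y :: "'k::finite \<Rightarrow> real^'n"
  assumes Q: "Q \<in> Gr k" and Q': "Q' \<in> Gr k" and y: "bessel y" and inv: "\<And>i. Q *v y i = y i"
  shows "(\<Sum>i\<in>UNIV. (norm (eigenproj Q' (y i) - y i))\<^sup>2) \<le> (norm (Q' - Q))\<^sup>2 / 8"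
proof -
  define M where "M = (mat 1 - Q') ** (mat 1 + Q)"
  \<comment> \<open>Since \<open>y i\<close> is fixed by \<open>Q\<close>, the factor
    \<open>mat 1 + Q\<close> merely doubles it.\<close>
  have "eigenproj Q' (y i) - y i = - ((1 / 4) *\<^sub>R (M *v y i))" for i
  proof -
    have "M *v y i = (mat 1 - Q') *v (2 *\<^sub>R y i)"
      unfolding M_def by (simp add: matrix_vector_mult_add_rdistrib inv scaleR_2 flip: matrix_vector_mul_assoc)
    also have "\<dots> = 2 *\<^sub>R (y i - Q' *v y i)"
      by (simp add: matrix_vector_mult_diff_rdistrib matrix_vector_mult_scaleR scaleR_diff_right)
    finally show ?thesis
      by (simp add: eigenproj_def vec_eq_iff field_simps)
  qed
  then have "(\<Sum>i\<in>UNIV. (norm (eigenproj Q' (y i) - y i))\<^sup>2) = (\<Sum>i\<in>UNIV. (norm (M *v y i))\<^sup>2) / 16"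
    by (simp add: power_divide sum_divide_distrib)
  also have "\<dots> \<le> (norm M)\<^sup>2 / 16"
    by (intro divide_right_mono bessel_matrix y) simp
  finally show ?thesis
    unfolding M_def norm_Gr_projection_defect[OF Q Q'] by simp
qed

subsection \<open>Lower bounds for the length\<close>

text \<open>The projected vectors \<open>z j i\<close> form the discrete lift of the polygon. The
  hypothesis on \<open>r\<close> keeps their norms above \<open>r\<close>, and the condition on the
  last vertex forces the \<open>i\<close>-th vector to turn by at least
  \<open>\<theta> i\<close>.\<close>

lemma polygon_length_ge:
  fixes Q :: "nat \<Rightarrow> real^'n::finite^'n" and y :: "'k::finite \<Rightarrow> real^'n" and \<theta> :: "'k \<Rightarrow> real"
  assumes Q: "\<And>j. j \<le> N \<Longrightarrow> Q j \<in> Gr k" and y: "bessel y" and inv: "\<And>i. Q 0 *v y i = y i"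
    and unit: "\<And>i. norm (y i) = 1"
    and \<theta>: "\<And>i. 0 \<le> \<theta> i \<and> \<theta> i \<le> pi / 2"
    and fin: "\<And>i. norm (eigenproj (Q N) (y i)) \<le> cos (\<theta> i)"
    and r: "0 < r" "r\<^sup>2 \<le> 1 - (\<Sum>j<N. (norm (Q (Suc j) - Q j))\<^sup>2) / 8"
  shows "r * (sqrt 8 * sqrt (\<Sum>i\<in>UNIV. (\<theta> i)\<^sup>2)) \<le> (\<Sum>j<N. norm (Q (Suc j) - Q j))"
proof -
  define z where "z = rec_nat y (\<lambda>j f i. eigenproj (Q (Suc j)) (f i))"
  have z0: "z 0 = y" and zSuc: "z (Suc j) i = eigenproj (Q (Suc j)) (z j i)" for j i
    by (simp_all add: z_def)
  have fixed: "Q j *v z j i = z j i" if "j \<le> N" for i j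
  proof (cases j)
    case (Suc l)
    with that show ?thesis using eigenproj_fixed[OF Q, of "Suc l" "z l i"] by (simp add: zSuc)
  qed (simp add: z0 inv)
  have bes: "bessel (z j)" if "j \<le> N" for j
    using that
  proof (induction j)
    case (Suc j)
    moreover have "z (Suc j) = (\<lambda>i. eigenproj (Q (Suc j)) (z j i))"
      by (simp add: zSuc fun_eq_iff)
    ultimately show ?case using bessel_eigenproj[OF Q, of "Suc j" "z j"] by simp
  qed (simp add: z0 y)
  have step: "(\<Sum>i\<in>UNIV. (norm (z (Suc j) i - z j i))\<^sup>2) \<le> (norm (Q (Suc j) - Q j))\<^sup>2 / 8" if "j < N" for j
    unfolding zSuc using that by (intro bessel_step[where k = k] Q bes fixed) auto
  have step1: "(norm (z (Suc j) i - z j i))\<^sup>2 \<le> (norm (Q (Suc j) - Q j))\<^sup>2 / 8" if "j < N" for j i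
    using step[OF that] member_le_sum[of i UNIV "\<lambda>i. (norm (z (Suc j) i - z j i))\<^sup>2"] by simp
  \<comment> \<open>By Pythagoras each projection costs the square of the displacement, so the total
    loss is quadratic in the chords.\<close>
  have norm_z: "1 - (\<Sum>l<j. (norm (Q (Suc l) - Q l))\<^sup>2) / 8 \<le> (norm (z j i))\<^sup>2" if "j \<le> N" for j i
    using that
  proof (induction j)
    case (Suc j)
    then show ?case
      using eigenproj_pythagoras[OF Q, of "Suc j" "z j i"] step1[of j i]
      by (simp add: zSuc add_divide_distrib)
  qed (simp add: z0 unit)
  have r_le: "r \<le> norm (z j i)" if "j \<le> N" for j i
  proof (rule power2_le_imp_le)
    have "(\<Sum>l<j. (norm (Q (Suc l) - Q l))\<^sup>2) \<le> (\<Sum>l<N. (norm (Q (Suc l) - Q l))\<^sup>2)"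
      using that by (intro sum_mono2) auto
    then show "r\<^sup>2 \<le> (norm (z j i))\<^sup>2"
      using norm_z[OF that, of i] r(2) by (simp add: field_simps)
  qed simp
  \<comment> \<open>The displacements of all frame vectors in step \<open>j\<close> are collected in
    one vector, so that the triangle inequality in this space combines the angles in the Euclidean
    norm.\<close>
  define \<delta> where "\<delta> = (\<lambda>j. \<chi> i. norm (z (Suc j) i - z j i))"
  have angle: "r * \<theta> i \<le> (\<Sum>j<N. \<delta> j $ i)" for i
  proof -
    have nz: "norm (z N i) > 0" using r_le[of N i] r(1) by linarith
    \<comment> \<open>The last vector lies in the +1 eigenspace of \<open>Q N\<close>, hence it only
      sees the projection of \<open>y i\<close> onto that space.\<close>
    have "y i \<bullet> z N i = eigenproj (Q N) (y i) \<bullet> z N i"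
      using eigenproj_self_adjoint[OF Q[of N], of "y i" "z N i"] eigenproj_idem[OF fixed[of N i]]
      by simp
    also have "\<dots> \<le> norm (eigenproj (Q N) (y i)) * norm (z N i)"
      by (rule norm_cauchy_schwarz)
    also have "\<dots> \<le> cos (\<theta> i) * norm (z N i)"
      by (intro mult_right_mono fin) simp
    finally have le: "sgn (z 0 i) \<bullet> sgn (z N i) \<le> cos (\<theta> i)"
      using nz by (simp add: z0 sgn_div_norm unit divide_simps)
    have "\<theta> i = arccos (cos (\<theta> i))"
      using \<theta>[of i] pi_gt_zero by (simp add: arccos_cos del: pi_gt_zero)
    also have "\<dots> \<le> arccos (sgn (z 0 i) \<bullet> sgn (z N i))"
    proof (rule arccos_le_arccos[OF _ le])
      have "\<bar>sgn (z 0 i) \<bullet> sgn (z N i)\<bar> \<le> 1"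
        using Cauchy_Schwarz_ineq2[of "sgn (z 0 i)" "sgn (z N i)"] unit nz
        by (simp add: norm_sgn z0 split: if_splits)
      then show "- 1 \<le> sgn (z 0 i) \<bullet> sgn (z N i)" by linarith
    qed simp
    also have "\<dots> \<le> (\<Sum>j<N. norm (z (Suc j) i - z j i)) / r"
      by (intro angle_le_polygon[where y = "\<lambda>j. z j i"] r(1) r_le)
        (auto simp: zSuc intro: eigenproj_orth[OF Q])
    finally show ?thesis
      using r(1) by (simp add: \<delta>_def field_simps)
  qed
  have "(r * sqrt (\<Sum>i\<in>UNIV. (\<theta> i)\<^sup>2)) = sqrt (\<Sum>i\<in>UNIV. (r * \<theta> i)\<^sup>2)"
    using r(1) by (simp add: power_mult_distrib real_sqrt_mult flip: sum_distrib_left)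
  also have "\<dots> \<le> sqrt (\<Sum>i\<in>UNIV. ((\<Sum>j<N. \<delta> j) $ i)\<^sup>2)"
    using angle r(1) \<theta> by (intro real_sqrt_le_mono sum_mono power_mono) auto
  also have "\<dots> = norm (\<Sum>j<N. \<delta> j)"
    by (simp add: norm_vec_def L2_set_def)
  also have "\<dots> \<le> (\<Sum>j<N. norm (\<delta> j))"
    by (rule norm_sum)
  also have "\<dots> \<le> (\<Sum>j<N. norm (Q (Suc j) - Q j) / sqrt 8)"
  proof (intro sum_mono)
    fix j assume "j \<in> {..<N}"
    then have "(norm (\<delta> j))\<^sup>2 \<le> (norm (Q (Suc j) - Q j) / sqrt 8)\<^sup>2"
      using step[of j] by (simp add: \<delta>_def norm_vec_def L2_set_def power_divide sum_nonneg)
    then show "norm (\<delta> j) \<le> norm (Q (Suc j) - Q j) / sqrt 8"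
      by (rule power2_le_imp_le) simp
  qed
  finally show ?thesis
    by (simp add: field_simps flip: sum_divide_distrib)
qed

text \<open>Fine subdivisions turn the curve into polygons with factor \<open>r\<close> arbitrarily
  close to 1. The function \<open>F\<close> stands for arc length; only its domination of the chords
  enters.\<close>

lemma Gr_curve_variation_ge:
  fixes d :: "real \<Rightarrow> real^'n::finite^'n" and y :: "'k::finite \<Rightarrow> real^'n" and \<theta> :: "'k \<Rightarrow> real"
  assumes ab: "a < b" and cont: "continuous_on {a..b} d"
    and d: "\<And>t. t \<in> {a..b} \<Longrightarrow> d t \<in> Gr k"
    and y: "bessel y" and inv: "\<And>i. d a *v y i = y i" and unit: "\<And>i. norm (y i) = 1"
    and \<theta>: "\<And>i. 0 \<le> \<theta> i \<and> \<theta> i \<le> pi / 2"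
    and fin: "\<And>i. norm (eigenproj (d b) (y i)) \<le> cos (\<theta> i)"
    and F: "\<And>s t. a \<le> s \<Longrightarrow> s \<le> t \<Longrightarrow> t \<le> b \<Longrightarrow> norm (d t - d s) \<le> F t - (F s :: real)"
  shows "sqrt 8 * sqrt (\<Sum>i\<in>UNIV. (\<theta> i)\<^sup>2) \<le> F b - F a"
proof (rule field_le_mult_one_interval)
  fix r :: real
  assume r: "0 < r" "r < 1"
  define L where "L = F b - F a"
  have L0: "0 \<le> L" using F[of a b] ab norm_ge_zero[of "d b - d a"] unfolding L_def by linarith
  \<comment> \<open>This mesh bound makes the squared chords sum to at most
    \<open>8 * (1 - r\<^sup>2)\<close>, as the polygon estimate requires. The summand 1 in the
    denominator covers \<open>L = 0\<close>.\<close>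
  define \<mu> where "\<mu> = 8 * (1 - r\<^sup>2) / (L + 1)"
  have r2: "r\<^sup>2 < 1" using r by (simp add: power_less_one_iff abs_square_less_1)
  then have mu: "0 < \<mu>" and muL: "\<mu> * L \<le> 8 * (1 - r\<^sup>2)"
    using L0 by (auto simp: \<mu>_def divide_simps algebra_simps)
  have "uniformly_continuous_on {a..b} d"
    using cont by (intro compact_uniformly_continuous) auto
  then obtain \<eta> where eta: "0 < \<eta>"
    and unif: "\<And>s t. s \<in> {a..b} \<Longrightarrow> t \<in> {a..b} \<Longrightarrow> dist t s < \<eta> \<Longrightarrow> dist (d t) (d s) < \<mu>"
    using mu unfolding uniformly_continuous_on_def by metis
  obtain N :: nat where N: "(b - a) / \<eta> < real N"
    using reals_Archimedean2 by blast
  with ab eta have N0: "0 < real N"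
    by (meson diff_gt_0_iff_gt divide_pos_pos less_trans)
  define \<tau> where "\<tau> = (\<lambda>j. a + real j * ((b - a) / real N))"
  have tau: "\<tau> 0 = a" "\<tau> N = b" using N0 by (auto simp: \<tau>_def)
  have tau_step: "\<tau> (Suc j) = \<tau> j + (b - a) / N" for j
    by (simp add: \<tau>_def algebra_simps add_divide_distrib diff_divide_distrib)
  have small: "0 \<le> (b - a) / N" "(b - a) / N < \<eta>" using N N0 eta ab by (auto simp: field_simps)
  have tau_in: "\<tau> j \<in> {a..b}" if "j \<le> N" for j
  proof -
    have "real j * ((b - a) / N) \<le> real N * ((b - a) / N)"
      using that small by (intro mult_right_mono) auto
    moreover have "0 \<le> real j * ((b - a) / N)"
      using small by (intro mult_nonneg_nonneg) auto
    ultimately show ?thesis using N0 by (simp add: \<tau>_def)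
  qed
  have chord: "norm (d (\<tau> (Suc j)) - d (\<tau> j)) \<le> F (\<tau> (Suc j)) - F (\<tau> j)"
    "norm (d (\<tau> (Suc j)) - d (\<tau> j)) \<le> \<mu>" if "j < N" for j
    using F[of "\<tau> j" "\<tau> (Suc j)"] unif[of "\<tau> j" "\<tau> (Suc j)"] tau_in[of j] tau_in[of "Suc j"] that small
    by (auto simp: tau_step dist_norm)
  have sum_le: "(\<Sum>j<N. norm (d (\<tau> (Suc j)) - d (\<tau> j))) \<le> L"
  proof -
    have "(\<Sum>j<N. norm (d (\<tau> (Suc j)) - d (\<tau> j))) \<le> (\<Sum>j<N. F (\<tau> (Suc j)) - F (\<tau> j))"
      using chord by (intro sum_mono) auto
    also have "\<dots> = L" by (simp add: sum_lessThan_telescope[of "\<lambda>j. F (\<tau> j)"] tau L_def)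
    finally show ?thesis .
  qed
  \<comment> \<open>A sum of squares is at most the largest chord times the total length.\<close>
  have "(\<Sum>j<N. (norm (d (\<tau> (Suc j)) - d (\<tau> j)))\<^sup>2) \<le> (\<Sum>j<N. \<mu> * norm (d (\<tau> (Suc j)) - d (\<tau> j)))"
    unfolding power2_eq_square using chord by (intro sum_mono mult_right_mono) auto
  also have "\<dots> \<le> \<mu> * L"
    unfolding sum_distrib_left[symmetric] using sum_le mu by (intro mult_left_mono) auto
  finally have sq: "(\<Sum>j<N. (norm (d (\<tau> (Suc j)) - d (\<tau> j)))\<^sup>2) \<le> 8 * (1 - r\<^sup>2)"
    using muL by simp
  have "r * (sqrt 8 * sqrt (\<Sum>i\<in>UNIV. (\<theta> i)\<^sup>2)) \<le> (\<Sum>j<N. norm (d (\<tau> (Suc j)) - d (\<tau> j)))"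
    using sq r
    by (intro polygon_length_ge[where Q = "\<lambda>j. d (\<tau> j)" and y = y and k = k] d tau_in y unit \<theta>)
      (auto simp: tau inv fin)
  then show "r * (sqrt 8 * sqrt (\<Sum>i\<in>UNIV. (\<theta> i)\<^sup>2)) \<le> F b - F a"
    using sum_le by (simp add: L_def)
qed

text \<open>The primitive of the speed serves as \<open>F\<close>. As the derivative may be
  unbounded near \<open>S\<close>, integrability is first obtained in the gauge sense and then
  improved by the finiteness of the length.\<close>

lemma variation_le_nn_integral:
  fixes d g :: "_ \<Rightarrow> 'a::euclidean_space"
  assumes ab: "a < b" and cont: "continuous_on {a..b} d" and S: "finite S"
    and der: "\<And>t. t \<in> {a<..<b} - S \<Longrightarrow> (d has_vector_derivative g t) (at t)"
    and fin: "(\<integral>\<^sup>+t\<in>{a..b}. ennreal (norm (g t)) \<partial>lborel) < \<infinity>"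
  obtains F :: "real \<Rightarrow> real" where
    "\<And>s t. a \<le> s \<Longrightarrow> s \<le> t \<Longrightarrow> t \<le> b \<Longrightarrow> norm (d t - d s) \<le> F t - F s"
    "ennreal (F b - F a) = (\<integral>\<^sup>+t\<in>{a..b}. ennreal (norm (g t)) \<partial>lborel)"
proof -
  \<comment> \<open>The gauge integral recovers a continuous function from its derivative despite a
    finite exceptional set; this also yields measurability of \<open>g\<close>.\<close>
  have ftc: "(g has_integral (d t - d s)) {s..t}" if "a \<le> s" "s \<le> t" "t \<le> b" for s t
    using that der
    by (intro fundamental_theorem_of_calculus_interior_strong[OF S] continuous_on_subset[OF cont]) auto
  then have "g integrable_on {a..b}" using ab by (meson less_eq_real_def has_integral_integrable order_refl)
  then have meas: "g \<in> borel_measurable (lebesgue_on {a..b})"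
    by (rule integrable_imp_measurable)
  have nn: "(\<integral>\<^sup>+t. ennreal (norm (g t)) \<partial>lebesgue_on {a..b}) =
      (\<integral>\<^sup>+t\<in>{a..b}. ennreal (norm (g t)) \<partial>lborel)"
    by (simp add: nn_integral_restrict_space nn_integral_completion)
  \<comment> \<open>A measurable function whose norm has finite Lebesgue integral is integrable, so
    the norm itself has a primitive.\<close>
  have int: "integrable (lebesgue_on {a..b}) g"
    using meas fin by (intro integrableI_bounded) (auto simp: nn)
  then have absint: "g absolutely_integrable_on {a..b}"
    by (simp add: absolutely_integrable_on_def set_integrable_def integrable_restrict_space)
  then have nint: "(\<lambda>t. norm (g t)) integrable_on {a..b}"
    by (rule absolutely_integrable_on_def[THEN iffD1, THEN conjunct2])
  define F where "F = (\<lambda>t. integral {a..t} (\<lambda>t. norm (g t)))"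
  show ?thesis
  proof (rule that[of F])
    fix s t assume st: "a \<le> s" "s \<le> t" "t \<le> b"
    have sub: "(\<lambda>t. norm (g t)) integrable_on {u..v}" if "a \<le> u" "v \<le> b" for u v
      using nint by (rule integrable_subinterval_real) (use that in auto)
    have "norm (d t - d s) = norm (integral {s..t} g)"
      using integral_unique[OF ftc[OF st]] by simp
    also have "\<dots> \<le> integral {s..t} (\<lambda>t. norm (g t))"
      using ftc[OF st] sub st by (intro integral_norm_bound_integral) auto
    also have "\<dots> = F t - F s"
      using Henstock_Kurzweil_Integration.integral_combine[of a s t "\<lambda>t. norm (g t)"] st sub[of a t]
      by (simp add: F_def)
    finally show "norm (d t - d s) \<le> F t - F s" .
  next
    have "(\<integral>\<^sup>+t. ennreal (norm (g t)) \<partial>lebesgue_on {a..b}) =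
        ennreal (integral\<^sup>L (lebesgue_on {a..b}) (\<lambda>t. norm (g t)))"
      using int by (intro nn_integral_eq_integral) auto
    also have "integral\<^sup>L (lebesgue_on {a..b}) (\<lambda>t. norm (g t)) = integral {a..b} (\<lambda>t. norm (g t))"
      using int by (intro lebesgue_integral_eq_integral) auto
    finally show "ennreal (F b - F a) = (\<integral>\<^sup>+t\<in>{a..b}. ennreal (norm (g t)) \<partial>lborel)"
      by (simp add: nn F_def)
  qed
qed

section \<open>Speed and length of curves in the Grassmannian\<close>

lemma symmetric_vector_derivative:
  fixes d :: "real \<Rightarrow> real^'n::finite^'n"
  assumes d: "(d has_vector_derivative X) (at t)" and U: "open U" "t \<in> U"
    and sym: "\<And>s. s \<in> U \<Longrightarrow> transpose (d s) = d s"
  shows "transpose X = X"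
proof -
  have "linear (transpose :: real^'n^'n \<Rightarrow> real^'n^'n)"
    by (rule linearI) (simp_all add: transpose_linear_simps)
  then have "((\<lambda>s. transpose (d s)) has_vector_derivative transpose X) (at t)"
    by (intro bounded_linear.has_vector_derivative[OF _ d]) (simp add: linear_conv_bounded_linear)
  then have "(d has_vector_derivative transpose X) (at t)"
    by (rule has_vector_derivative_transform_within_open[OF _ U]) (rule sym)
  then show ?thesis
    using d vector_derivative_unique_at by blast
qed

lemma Gr_metric_symmetric: "transpose X = X \<Longrightarrow> Gr_metric Q X X = (norm X)\<^sup>2"
  by (simp add: Gr_metric_def power2_norm_eq_inner inner_matrix_eq_trace)

lemma Gr_curve_length_ge:
  fixes d :: "real \<Rightarrow> real^'n::finite^'n" and y :: "'k::finite \<Rightarrow> real^'n" and \<theta> :: "'k \<Rightarrow> real"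
  assumes ab: "a < b" and pw: "d piecewise_C1_differentiable_on {a..b}"
    and d: "d ` {a..b} \<subseteq> Gr k"
    and y: "bessel y" and inv: "\<And>i. d a *v y i = y i" and unit: "\<And>i. norm (y i) = 1"
    and \<theta>: "\<And>i. 0 \<le> \<theta> i \<and> \<theta> i \<le> pi / 2"
    and fin: "\<And>i. norm (eigenproj (d b) (y i)) \<le> cos (\<theta> i)"
  shows "ennreal (sqrt 8 * sqrt (\<Sum>i\<in>UNIV. (\<theta> i)\<^sup>2)) \<le> curve_length Gr_metric a b d"
proof -
  define g where "g = (\<lambda>t. vector_derivative d (at t within {a..b}))"
  obtain S where S: "finite S" and C1: "d C1_differentiable_on ({a..b} - S)"
    and cont: "continuous_on {a..b} d"
    using pw unfolding piecewise_C1_differentiable_on_def by blast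
  have der: "(d has_vector_derivative g t) (at t)" if "t \<in> {a<..<b} - S" for t
  proof -
    from that have "t \<in> {a..b} - S" by auto
    then obtain X where X: "(d has_vector_derivative X) (at t)"
      using C1 unfolding C1_differentiable_on_def by blast
    moreover from X have "g t = X"
      unfolding g_def using that ab
      by (intro vector_derivative_within_closed_interval has_vector_derivative_at_within[OF X]) auto
    ultimately show ?thesis by simp
  qed
  have speed: "sqrt (Gr_metric (d t) (g t) (g t)) = norm (g t)" if t: "t \<in> {a<..<b} - S" for t
  proof -
    have "transpose (g t) = g t"
      using t d by (intro symmetric_vector_derivative[OF der[OF t], of "{a<..<b}"] GrD(1)) auto
    then show ?thesis by (simp add: Gr_metric_symmetric)
  qed
  \<comment> \<open>End points and exceptional points form a null set. Elsewhere the velocity is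
    symmetric, so the metric gives its Frobenius norm.\<close>
  have ae: "AE t in lborel. t \<notin> insert a (insert b S)"
    using S by (intro AE_not_in finite_imp_null_set_lborel) auto
  have len: "curve_length Gr_metric a b d = (\<integral>\<^sup>+t\<in>{a..b}. ennreal (norm (g t)) \<partial>lborel)"
    unfolding curve_length_def Let_def
  proof (rule nn_integral_cong_AE, rule eventually_mono[OF ae])
    fix t assume "t \<notin> insert a (insert b S)"
    then show "ennreal (sqrt (Gr_metric (d t) (vector_derivative d (at t within {a..b}))
          (vector_derivative d (at t within {a..b})))) * indicator {a..b} t =
        ennreal (norm (g t)) * indicator {a..b} t"
      using speed[of t] by (auto simp: g_def indicator_def)
  qed
  show ?thesis
  proof (cases "curve_length Gr_metric a b d < \<infinity>")
    case True
    obtain F where F: "\<And>s t. a \<le> s \<Longrightarrow> s \<le> t \<Longrightarrow> t \<le> b \<Longrightarrow> norm (d t - d s) \<le> F t - F s"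
      and Fint: "ennreal (F b - F a) = (\<integral>\<^sup>+t\<in>{a..b}. ennreal (norm (g t)) \<partial>lborel)"
      using variation_le_nn_integral[OF ab cont S der] True unfolding len by blast
    have "sqrt 8 * sqrt (\<Sum>i\<in>UNIV. (\<theta> i)\<^sup>2) \<le> F b - F a"
      using d by (intro Gr_curve_variation_ge[OF ab cont _ y inv unit \<theta> fin F]) auto
    then show ?thesis unfolding len Fint[symmetric] by (rule ennreal_leI)
  qed (simp add: not_less top.extremum_unique)
qed

subsection \<open>Tangent vectors of the Grassmannian\<close>

lemma has_vector_derivative_matrix:
  fixes f :: "real \<Rightarrow> real^'n^'m"
  assumes "\<And>i j. ((\<lambda>t. f t $ i $ j) has_vector_derivative f' $ i $ j) (at t within X)"
  shows "(f has_vector_derivative f') (at t within X)"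
  using assms unfolding has_vector_derivative_def
  by (subst has_derivative_componentwise_within) (auto simp: Basis_vec_def inner_axis)

lemma sums_matrix:
  fixes f :: "nat \<Rightarrow> real^'n^'m"
  assumes "\<And>i j. (\<lambda>m. f m $ i $ j) sums (L $ i $ j)"
  shows "f sums L"
  using assms unfolding sums_def by (auto intro!: vec_tendstoI)

lemma bounded_bilinear_matrix_mul:
  "bounded_bilinear ((**) :: real^'n^'m \<Rightarrow> real^'k^'n \<Rightarrow> real^'k^'m)"
  unfolding bilinear_conv_bounded_bilinear[symmetric] bilinear_def
  by (auto intro: linear_matrix_mul_left linear_matrix_mul_right)

lemma orthogonal_matrixD:
  assumes "orthogonal_matrix Q"
  shows "transpose Q ** Q = mat 1" "Q ** transpose Q = mat 1"
  using assms by (auto simp: orthogonal_matrix_def)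

lemma inner_matrix_mul_left:
  "(A ** X) \<bullet> Y = X \<bullet> (transpose A ** Y)" for A :: "real^'n^'m"
  by (simp add: inner_matrix_eq_trace matrix_transpose_mul matrix_mul_assoc)

lemma inner_matrix_mul_right:
  "(X ** A) \<bullet> Y = X \<bullet> (Y ** transpose A)" for A :: "real^'n^'m"
proof -
  have "(X ** A) \<bullet> Y = trace (transpose A ** (transpose X ** Y))"
    by (simp add: inner_matrix_eq_trace matrix_transpose_mul matrix_mul_assoc)
  also have "\<dots> = X \<bullet> (Y ** transpose A)"
    by (subst trace_mul_sym) (simp add: inner_matrix_eq_trace matrix_mul_assoc)
  finally show ?thesis .
qed

lemma norm_orthogonal_matrix_mul_left:
  fixes X :: "real^'n^'n"
  assumes "orthogonal_matrix Q" shows "norm (Q ** X) = norm X"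
  by (simp add: norm_eq_sqrt_inner inner_matrix_mul_left matrix_mul_assoc orthogonal_matrixD[OF assms])

lemma norm_orthogonal_matrix_mul_right:
  fixes X :: "real^'n^'n"
  assumes "orthogonal_matrix Q" shows "norm (X ** Q) = norm X"
  by (simp add: norm_eq_sqrt_inner inner_matrix_mul_right orthogonal_matrixD[OF assms]
      flip: matrix_mul_assoc)

text \<open>Conjugation by an orthogonal matrix is multiplicative and continuous linear, so it
  passes through the powers and through the series. Convergence enters through the sum
  \<open>E\<close>.\<close>

lemma matrix_exp_conj:
  fixes A :: "real^'n::finite^'n"
  assumes Q: "orthogonal_matrix Q" and E: "(\<lambda>m. (1 / fact m) *\<^sub>R matrix_pow A m) sums E"
  shows "matrix_exp (Q ** A ** transpose Q) = Q ** E ** transpose Q"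
proof -
  have pow: "matrix_pow (Q ** A ** transpose Q) m = Q ** matrix_pow A m ** transpose Q" for m
  proof (induction m)
    case (Suc m)
    have "matrix_pow (Q ** A ** transpose Q) (Suc m) =
        Q ** A ** (transpose Q ** Q) ** matrix_pow A m ** transpose Q"
      by (simp add: Suc matrix_mul_assoc)
    then show ?case by (simp add: orthogonal_matrixD[OF Q] matrix_mul_assoc)
  qed (simp add: orthogonal_matrixD[OF Q])
  have "bounded_linear (\<lambda>X. Q ** X ** transpose Q)"
    unfolding linear_conv_bounded_linear[symmetric]
    by (rule linearI) (simp_all add: matrix_mul_linear_simps)
  from bounded_linear.sums[OF this E]
  have "(\<lambda>m. (1 / fact m) *\<^sub>R matrix_pow (Q ** A ** transpose Q) m) sums (Q ** E ** transpose Q)"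
    by (simp add: pow matrix_mul_linear_simps)
  then show ?thesis
    unfolding matrix_exp_def by (rule sums_unique[symmetric])
qed

text \<open>A solution of an autonomous linear equation is smooth: each differentiation applies
  \<open>L\<close> once more.\<close>

lemma jet_on_linear_flow:
  assumes L: "bounded_linear L"
    and c: "\<And>t. (c has_vector_derivative L (c t)) (at t within I)"
  shows "jet_on I (\<lambda>m t. (L ^^ m) (c t))"
  unfolding jet_on_def
proof (intro allI ballI)
  fix m t
  have "bounded_linear (L ^^ m)"
    by (induction m) (auto intro: bounded_linear_compose[OF L] simp: o_def id_def)
  from bounded_linear.has_vector_derivative[OF this c]
  show "((\<lambda>t. (L ^^ m) (c t)) has_vector_derivative (L ^^ Suc m) (c t)) (at t within I)"
    by (simp add: funpow_swap1)
qed

text \<open>Differentiating \<open>D 0 t ** D 0 t = mat 1\<close> at 0 gives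
  \<open>Q ** X + X ** Q = 0\<close>.\<close>

lemma tangent_space_Gr_anticommute:
  fixes X :: "real^'n::finite^'n"
  assumes "X \<in> tangent_space (Gr k) Q"
  shows "X ** Q = - (Q ** X)"
proof -
  from assms obtain D \<epsilon> where e: "\<epsilon> > 0" and D: "jet_on {-\<epsilon><..<\<epsilon>} D"
    and M: "\<forall>t\<in>{-\<epsilon><..<\<epsilon>}. D 0 t \<in> Gr k" and D0: "D 0 0 = Q" and X: "X = D 1 0"
    unfolding tangent_space_def by blast
  have zero: "0 \<in> {-\<epsilon><..<\<epsilon>}" using e by simp
  have "(D 0 has_vector_derivative X) (at 0)"
    using D e X at_within_open[OF zero] unfolding jet_on_def by force
  from bounded_bilinear.has_vector_derivative[OF bounded_bilinear_matrix_mul this this]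
  have "((\<lambda>t. D 0 t ** D 0 t) has_vector_derivative (Q ** X + X ** Q)) (at 0)"
    by (simp add: D0)
  then have "((\<lambda>t. mat 1) has_vector_derivative (Q ** X + X ** Q)) (at 0)"
    by (rule has_vector_derivative_transform_within_open[OF _ open_greaterThanLessThan zero])
      (use M in \<open>auto intro: GrD\<close>)
  then have "Q ** X + X ** Q = 0"
    using vector_derivative_unique_at has_vector_derivative_const by blast
  then show ?thesis by (simp add: eq_neg_iff_add_eq_0 add.commute)
qed

text \<open>Conjugation by \<open>Q\<close> preserves the inner product, fixes \<open>Y\<close> and
  negates \<open>X\<close>; eigenvectors for the eigenvalues 1 and -1 are orthogonal.\<close>

lemma tangent_space_Gr_inner_commuting:
  fixes X Y :: "real^'n::finite^'n"
  assumes Q: "Q \<in> Gr k" and X: "X \<in> tangent_space (Gr k) Q" and Y: "Y ** Q = Q ** Y"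
  shows "Y \<bullet> X = 0"
proof -
  note q = GrD[OF Q]
  have "Q ** X ** Q = - X"
    using tangent_space_Gr_anticommute[OF X]
    by (simp add: matrix_mul_linear_simps matrix_mul_assoc q flip: matrix_mul_assoc[of Q X Q])
  have "Q ** Y ** Q = Y"
    by (simp add: Y q matrix_mul_assoc flip: matrix_mul_assoc[of Q Y Q])
  then have "Y \<bullet> X = (Q ** Y ** Q) \<bullet> X" by simp
  also have "\<dots> = (Q ** Y) \<bullet> (X ** Q)"
    by (simp only: inner_matrix_mul_right[of "Q ** Y"] q)
  also have "\<dots> = Y \<bullet> (Q ** X ** Q)"
    by (simp only: inner_matrix_mul_left[of Q Y] q matrix_mul_assoc)
  also have "\<dots> = - (Y \<bullet> X)"
    by (simp add: \<open>Q ** X ** Q = - X\<close>)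
  finally show ?thesis by simp
qed

subsection \<open>Simultaneous rotations in orthogonal planes\<close>

text \<open>Row \<open>a\<close> is supported on the columns \<open>a\<close> and
  \<open>\<sigma> a\<close>; at a fixed point of \<open>\<sigma>\<close> the two entries coincide in
  position and add up. For an involution such matrices are closed under products, which reduces the
  matrix identities below to scalar ones.\<close>

definition pair_matrix :: "('n \<Rightarrow> 'n) \<Rightarrow> ('n \<Rightarrow> real) \<Rightarrow> ('n \<Rightarrow> real) \<Rightarrow> real^'n::finite^'n" where
  "pair_matrix \<sigma> c s = (\<chi> a b. (if b = a then c a else 0) + (if b = \<sigma> a then s a else 0))"

lemma pair_matrix_mult_nth:
  "(pair_matrix \<sigma> c s ** X) $ a $ b = c a * X $ a $ b + s a * X $ \<sigma> a $ b"
  by (simp add: matrix_matrix_mult_def pair_matrix_def distrib_right sum.distrib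
      if_distrib[of "\<lambda>x. x * _"] cong: if_cong)

lemma scaleR_pair_matrix:
  "r *\<^sub>R pair_matrix \<sigma> c s = pair_matrix \<sigma> (\<lambda>a. r * c a) (\<lambda>a. r * s a)"
  by (simp add: pair_matrix_def vec_eq_iff distrib_left)

lemma mat_1_eq_pair_matrix: "mat 1 = pair_matrix \<sigma> (\<lambda>_. 1) (\<lambda>_. 0)"
  by (simp add: mat_def pair_matrix_def vec_eq_iff)

text \<open>
  The involution \<open>\<sigma>\<close> pairs the coordinates spanning the rotation planes; its fixed points carry the
  angle \<open>0\<close>.
\<close>

locale plane_rotations =
  fixes \<sigma> :: "'n::finite \<Rightarrow> 'n" and \<epsilon> \<omega> :: "'n \<Rightarrow> real"
  assumes \<sigma>: "\<sigma> (\<sigma> a) = a" and \<omega>: "\<omega> (\<sigma> a) = \<omega> a" and \<epsilon>: "\<epsilon> a * \<epsilon> a = 1"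
    and \<epsilon>_\<sigma>: "\<epsilon> (\<sigma> a) = - \<epsilon> a \<or> \<omega> a = 0"
begin

definition rot :: "real \<Rightarrow> real^'n^'n" where
  "rot t = pair_matrix \<sigma> (\<lambda>a. cos (t * \<omega> a)) (\<lambda>a. \<epsilon> a * sin (t * \<omega> a))"

definition gen :: "real^'n^'n" where
  "gen = pair_matrix \<sigma> (\<lambda>_. 0) (\<lambda>a. \<epsilon> a * \<omega> a)"

text \<open>This is the diagonal matrix of the signs, put in the common form so that the same
  product formula applies.\<close>

definition sig :: "real^'n^'n" where
  "sig = pair_matrix \<sigma> \<epsilon> (\<lambda>_. 0)"

lemma pair_matrix_mult:
  "pair_matrix \<sigma> c s ** pair_matrix \<sigma> c' s' =
    pair_matrix \<sigma> (\<lambda>a. c a * c' a + s a * s' (\<sigma> a)) (\<lambda>a. c a * s' a + s a * c' (\<sigma> a))"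
  unfolding vec_eq_iff pair_matrix_mult_nth
  by (auto simp: pair_matrix_def \<sigma> algebra_simps)

lemma transpose_pair_matrix: "transpose (pair_matrix \<sigma> c s) = pair_matrix \<sigma> c (\<lambda>a. s (\<sigma> a))"
  using \<sigma> by (auto simp: transpose_def pair_matrix_def vec_eq_iff)

lemma pair_matrix_cong:
  "(\<And>a. c a = c' a) \<Longrightarrow> (\<And>a. s a = s' a) \<Longrightarrow> pair_matrix \<sigma> c s = pair_matrix \<sigma> c' s'"
  by (simp add: pair_matrix_def vec_eq_iff)

text \<open>Either the sign flips between partners, or the angle is 0 and both
  \<open>\<omega> a\<close> and its sine vanish. Hence the rules with
  \<open>\<epsilon> (\<sigma> a)\<close> hold at fixed points too.\<close>

lemma \<epsilon>_\<sigma>_mult: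
  "\<epsilon> a * (\<epsilon> (\<sigma> a) * sin (t * \<omega> a)) = - sin (t * \<omega> a)" "\<epsilon> a * (\<epsilon> (\<sigma> a) * \<omega> a) = - \<omega> a"
  "\<epsilon> a * (\<omega> a * \<epsilon> (\<sigma> a)) = - \<omega> a" "\<epsilon> a * (\<epsilon> a * x) = x"
  "\<epsilon> (\<sigma> a) * sin (t * \<omega> a) = - (\<epsilon> a * sin (t * \<omega> a))" "\<epsilon> (\<sigma> a) * \<omega> a = - (\<epsilon> a * \<omega> a)"
proof -
  show *: "\<epsilon> a * (\<epsilon> a * x) = x" for x
    using \<epsilon>[of a] by (simp flip: mult.assoc)
  show "\<epsilon> a * (\<epsilon> (\<sigma> a) * sin (t * \<omega> a)) = - sin (t * \<omega> a)"
    "\<epsilon> a * (\<epsilon> (\<sigma> a) * \<omega> a) = - \<omega> a" "\<epsilon> a * (\<omega> a * \<epsilon> (\<sigma> a)) = - \<omega> a"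
    "\<epsilon> (\<sigma> a) * sin (t * \<omega> a) = - (\<epsilon> a * sin (t * \<omega> a))" "\<epsilon> (\<sigma> a) * \<omega> a = - (\<epsilon> a * \<omega> a)"
    using \<epsilon>_\<sigma>[of a] by (auto simp: * mult.left_commute[of "\<epsilon> a" "\<omega> a"] \<epsilon>)
qed

lemma rot_0: "rot 0 = mat 1"
  by (simp add: rot_def mat_1_eq_pair_matrix[of \<sigma>])

lemma rot_add: "rot s ** rot t = rot (s + t)"
  unfolding rot_def pair_matrix_mult
proof (rule pair_matrix_cong)
  fix a
  have "\<epsilon> a * sin (s * \<omega> a) * (\<epsilon> (\<sigma> a) * sin (t * \<omega> (\<sigma> a))) =
      sin (s * \<omega> a) * (\<epsilon> a * (\<epsilon> (\<sigma> a) * sin (t * \<omega> a)))"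
    by (simp add: \<omega>)
  also have "\<dots> = - (sin (s * \<omega> a) * sin (t * \<omega> a))"
    by (simp only: \<epsilon>_\<sigma>_mult(1) mult_minus_right)
  finally show "cos (s * \<omega> a) * cos (t * \<omega> a) +
      \<epsilon> a * sin (s * \<omega> a) * (\<epsilon> (\<sigma> a) * sin (t * \<omega> (\<sigma> a))) = cos ((s + t) * \<omega> a)"
    by (simp add: cos_add distrib_right)
qed (simp add: \<omega> sin_add algebra_simps)

lemma transpose_rot: "transpose (rot t) = rot (- t)"
  by (simp add: rot_def transpose_pair_matrix \<omega> \<epsilon>_\<sigma>_mult)

text \<open>In each rotation plane \<open>sig\<close> is a reflection, and a reflection conjugates a
  rotation to its inverse.\<close>

lemma sig_rot: "sig ** rot t = rot (- t) ** sig"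
  unfolding sig_def rot_def pair_matrix_mult
proof (rule pair_matrix_cong)
  fix a
  show "\<epsilon> a * (\<epsilon> a * sin (t * \<omega> a)) + 0 * cos (t * \<omega> (\<sigma> a)) =
      cos (- t * \<omega> a) * 0 + \<epsilon> a * sin (- t * \<omega> a) * \<epsilon> (\<sigma> a)"
    using \<epsilon>_\<sigma>_mult(1)[of a t] by (simp add: \<epsilon>_\<sigma>_mult mult.assoc mult.commute[of _ "\<epsilon> (\<sigma> a)"]
        mult.left_commute[of "\<epsilon> (\<sigma> a)" "\<epsilon> a"])
qed simp

lemma sig_sig: "sig ** sig = mat 1"
  by (simp add: sig_def pair_matrix_mult \<epsilon> mat_1_eq_pair_matrix[of \<sigma>])

lemma transpose_sig: "transpose sig = sig"
  by (simp add: sig_def transpose_pair_matrix)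

lemma gen_rot: "gen ** rot t = rot t ** gen"
  unfolding gen_def rot_def pair_matrix_mult
  by (rule pair_matrix_cong) (simp_all add: \<omega> \<epsilon>_\<sigma>_mult mult_ac)

lemma gen_sig: "gen ** sig = - (sig ** gen)"
  unfolding gen_def sig_def pair_matrix_mult
  by (simp add: pair_matrix_def vec_eq_iff \<epsilon>_\<sigma>_mult \<epsilon> mult_ac)

lemma norm_gen: "(norm gen)\<^sup>2 = (\<Sum>a\<in>UNIV. (\<omega> a)\<^sup>2)"
proof -
  have "gen $ a = axis (\<sigma> a) (\<epsilon> a * \<omega> a)" for a
    by (simp add: gen_def pair_matrix_def axis_def vec_eq_iff)
  then have "gen $ a \<bullet> gen $ a = (\<omega> a)\<^sup>2" for a
    by (simp add: inner_axis_axis \<epsilon>_\<sigma>_mult power2_eq_square mult.assoc mult.left_commute[of "\<omega> a"])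
  then show ?thesis
    by (simp add: power2_norm_eq_inner inner_vec_def[of gen])
qed

lemma has_vector_derivative_rot: "(rot has_vector_derivative gen ** rot t) (at t within X)"
proof (rule has_vector_derivative_matrix)
  fix a b
  have "\<epsilon> a * \<omega> a * (\<epsilon> (\<sigma> a) * sin (t * \<omega> a)) = \<epsilon> a * (\<epsilon> (\<sigma> a) * \<omega> a) * sin (t * \<omega> a)"
    by (simp only: mult_ac)
  then have "\<epsilon> a * \<omega> a * (\<epsilon> (\<sigma> a) * sin (t * \<omega> a)) = - \<omega> a * sin (t * \<omega> a)"
    by (simp only: \<epsilon>_\<sigma>_mult(2))
  then have "(gen ** rot t) $ a $ b = (if b = a then - \<omega> a * sin (t * \<omega> a) else 0) +
      (if b = \<sigma> a then \<epsilon> a * (\<omega> a * cos (t * \<omega> a)) else 0)"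
    unfolding gen_def rot_def pair_matrix_mult
    by (cases "\<sigma> a = a") (simp_all add: pair_matrix_def \<omega>)
  then show "((\<lambda>t. rot t $ a $ b) has_vector_derivative (gen ** rot t) $ a $ b) (at t within X)"
    by (auto simp: rot_def pair_matrix_def simp flip: has_real_derivative_iff_has_vector_derivative
        intro!: derivative_eq_intros)
qed

text \<open>Powers of \<open>gen\<close> alternate between diagonal and paired entries. The library
  coefficients vanish for the wrong parity, so a single formula covers even and odd
  \<open>m\<close>.\<close>

lemma matrix_pow_gen:
  "(1 / fact m) *\<^sub>R matrix_pow (t *\<^sub>R gen) m =
    pair_matrix \<sigma> (\<lambda>a. cos_coeff m * (t * \<omega> a) ^ m) (\<lambda>a. \<epsilon> a * (sin_coeff m * (t * \<omega> a) ^ m))"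
proof (induction m)
  case 0
  then show ?case
    by (simp add: mat_1_eq_pair_matrix[of \<sigma>])
next
  case (Suc m)
  have "(1 / fact (Suc m)) *\<^sub>R matrix_pow (t *\<^sub>R gen) (Suc m) =
      (t / Suc m) *\<^sub>R (gen ** ((1 / fact m) *\<^sub>R matrix_pow (t *\<^sub>R gen) m))"
    by (simp add: matrix_mul_linear_simps)
  also have "\<dots> = (t / Suc m) *\<^sub>R pair_matrix \<sigma> (\<lambda>a. \<epsilon> a * (\<epsilon> (\<sigma> a) * \<omega> a) * (sin_coeff m * (t * \<omega> a) ^ m))
      (\<lambda>a. \<epsilon> a * \<omega> a * (cos_coeff m * (t * \<omega> a) ^ m))"
    unfolding Suc unfolding gen_def pair_matrix_mult by (simp add: \<omega> mult_ac)
  also have "\<dots> = pair_matrix \<sigma> (\<lambda>a. cos_coeff (Suc m) * (t * \<omega> a) ^ Suc m)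
      (\<lambda>a. \<epsilon> a * (sin_coeff (Suc m) * (t * \<omega> a) ^ Suc m))"
    unfolding scaleR_pair_matrix
    by (rule pair_matrix_cong) (simp_all add: \<epsilon>_\<sigma>_mult cos_coeff_Suc sin_coeff_Suc)
  finally show ?case .
qed

lemma matrix_exp_sums_rot: "(\<lambda>m. (1 / fact m) *\<^sub>R matrix_pow (t *\<^sub>R gen) m) sums rot t"
proof (rule sums_matrix)
  fix a b
  have "(\<lambda>m. cos_coeff m * (t * \<omega> a) ^ m) sums cos (t * \<omega> a)"
    "(\<lambda>m. sin_coeff m * (t * \<omega> a) ^ m) sums sin (t * \<omega> a)"
    using cos_converges[of "t * \<omega> a"] sin_converges[of "t * \<omega> a"] by simp_all
  then show "(\<lambda>m. ((1 / fact m) *\<^sub>R matrix_pow (t *\<^sub>R gen) m) $ a $ b) sums (rot t $ a $ b)"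
    unfolding matrix_pow_gen
    by (auto simp: pair_matrix_def rot_def intro!: sums_add sums_mult)
qed

end

section \<open>Conjugation by an orthogonal matrix\<close>

lemma orthogonal_conj_mult:
  fixes N :: "real^'n^'n"
  assumes "orthogonal_matrix N"
  shows "(N ** X ** transpose N) ** (N ** Y ** transpose N) = N ** (X ** Y) ** transpose N"
proof -
  have "(N ** X ** transpose N) ** (N ** Y ** transpose N) =
      N ** X ** (transpose N ** N) ** Y ** transpose N"
    by (simp only: matrix_mul_assoc)
  then show ?thesis
    by (simp add: orthogonal_matrixD[OF assms] matrix_mul_assoc)
qed

lemma transpose_conj: "transpose (N ** X ** transpose N) = N ** transpose X ** transpose N"
  for N :: "real^'n^'n"
  by (simp add: matrix_transpose_mul matrix_mul_assoc)

lemma trace_orthogonal_conj: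
  fixes N :: "real^'n^'n"
  assumes "orthogonal_matrix N"
  shows "trace (N ** X ** transpose N) = trace X"
proof -
  have "trace (N ** X ** transpose N) = trace (transpose N ** N ** X)"
    by (subst trace_mul_sym) (simp add: matrix_mul_assoc)
  then show ?thesis
    by (simp add: orthogonal_matrixD[OF assms])
qed

lemma norm_orthogonal_conj:
  fixes N :: "real^'n^'n"
  assumes "orthogonal_matrix N"
  shows "norm (N ** X ** transpose N) = norm X"
  using assms
  by (simp add: norm_orthogonal_matrix_mul_left norm_orthogonal_matrix_mul_right)

section \<open>The curve obtained by rotating the signature matrix\<close>

context plane_rotations
begin

text \<open>The angle is doubled because \<open>rot t ** sig ** rot (- t)\<close> collapses to
  \<open>rot (2 * t) ** sig\<close>.\<close>

definition flow :: "real^'n^'n \<Rightarrow> real \<Rightarrow> real^'n^'n" where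
  "flow N t = N ** (rot (2 * t) ** sig) ** transpose N"

lemma rot_sig_rot: "rot t ** sig ** rot (- t) = rot (2 * t) ** sig"
  using sig_rot[of "- t"] by (simp add: matrix_mul_assoc[symmetric])
    (simp add: matrix_mul_assoc rot_add flip: mult_2)

lemma transpose_rot_sig: "transpose (rot t ** sig) = rot t ** sig"
  by (simp add: matrix_transpose_mul transpose_rot transpose_sig sig_rot)

lemma rot_sig_rot_sig: "(rot t ** sig) ** (rot t ** sig) = mat 1"
proof -
  have "(rot t ** sig) ** (rot t ** sig) = rot t ** (sig ** rot t) ** sig"
    by (simp only: matrix_mul_assoc)
  also have "\<dots> = (rot t ** rot (- t)) ** (sig ** sig)"
    unfolding sig_rot by (simp only: matrix_mul_assoc)
  finally show ?thesis
    by (simp add: rot_add rot_0 sig_sig)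
qed

lemma orthogonal_rot: "orthogonal_matrix (rot t)"
  by (simp add: orthogonal_matrix transpose_rot rot_add rot_0)

lemma flow_in_Gr:
  assumes N: "orthogonal_matrix N" and tr: "trace sig = 2 * real k - real CARD('n)"
  shows "flow N t \<in> Gr k"
proof -
  have "trace (flow N t) = trace (rot t ** sig ** transpose (rot t))"
    by (simp add: flow_def trace_orthogonal_conj[OF N] transpose_rot rot_sig_rot)
  also have "\<dots> = trace sig"
    by (rule trace_orthogonal_conj[OF orthogonal_rot])
  finally show ?thesis
    using tr by (simp add: Gr_def flow_def orthogonal_matrix transpose_conj transpose_rot_sig
        orthogonal_conj_mult[OF N] rot_sig_rot_sig orthogonal_matrixD[OF N])
qed

lemma has_vector_derivative_flow:
  assumes N: "orthogonal_matrix N"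
  shows "(flow N has_vector_derivative (2 *\<^sub>R (N ** gen ** transpose N)) ** flow N t) (at t within X)"
proof -
  have "((\<lambda>t. rot (2 * t)) has_vector_derivative 2 *\<^sub>R (gen ** rot (2 * t))) (at t within X)"
    using vector_diff_chain_within[OF _ has_vector_derivative_rot, of "\<lambda>t. 2 * t" 2 t X]
    by (auto simp: o_def intro!: derivative_eq_intros simp flip: has_real_derivative_iff_has_vector_derivative)
  moreover have "bounded_linear (\<lambda>X. N ** (X ** sig) ** transpose N)"
    unfolding linear_conv_bounded_linear[symmetric]
    by (rule linearI) (simp_all add: matrix_mul_linear_simps)
  ultimately have "(flow N has_vector_derivative N ** (2 *\<^sub>R (gen ** rot (2 * t)) ** sig) ** transpose N)
      (at t within X)"
    unfolding flow_def by (rule bounded_linear.has_vector_derivative[rotated])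
  moreover have "(2 *\<^sub>R (N ** gen ** transpose N)) ** flow N t =
      N ** (2 *\<^sub>R (gen ** rot (2 * t)) ** sig) ** transpose N"
    by (simp add: flow_def matrix_mul_linear_simps orthogonal_conj_mult[OF N])
      (simp add: matrix_mul_assoc)
  ultimately show ?thesis by simp
qed

lemma flow_geodesic:
  assumes N: "orthogonal_matrix N" and tr: "trace sig = 2 * real k - real CARD('n)"
  shows "geodesic_on (Gr k) a b (flow N)"
  unfolding geodesic_on_def
proof (intro conjI exI[of _ "\<lambda>m t. (((**) (2 *\<^sub>R (N ** gen ** transpose N))) ^^ m) (flow N t)"] ballI)
  show "flow N ` {a..b} \<subseteq> Gr k"
    using flow_in_Gr[OF assms] by auto
  show "jet_on {a..b} (\<lambda>m t. (((**) (2 *\<^sub>R (N ** gen ** transpose N))) ^^ m) (flow N t))"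
    by (intro jet_on_linear_flow has_vector_derivative_flow[OF N])
      (simp add: linear_matrix_mul_left flip: linear_conv_bounded_linear)
  fix t v assume v: "v \<in> tangent_space (Gr k) (flow N t)"
  \<comment> \<open>Each \<open>gen\<close> passes \<open>rot s\<close> unchanged and
    \<open>sig\<close> with a minus sign; for two copies the signs cancel. This is what makes the
    second derivative commute with the curve.\<close>
  have "gen ** (gen ** (rot s ** sig)) = (rot s ** sig) ** (gen ** gen)" for s
  proof -
    have "gen ** (gen ** (rot s ** sig)) = (gen ** rot s) ** (gen ** sig)"
      by (simp add: matrix_mul_assoc gen_rot flip: matrix_mul_assoc[of gen gen])
    also have "\<dots> = rot s ** gen ** (- (sig ** gen))"
      by (simp only: gen_rot gen_sig)
    also have "\<dots> = - (rot s ** (gen ** sig) ** gen)"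
      by (simp add: matrix_mul_linear_simps matrix_mul_assoc)
    also have "\<dots> = (rot s ** sig) ** (gen ** gen)"
      unfolding gen_sig by (simp add: matrix_mul_linear_simps matrix_mul_assoc)
    finally show ?thesis .
  qed
  note commute = this
  have "gen ** (gen ** (rot s ** sig)) ** (rot s ** sig) =
      (rot s ** sig) ** (gen ** (gen ** (rot s ** sig)))" for s
    unfolding commute by (simp only: commute flip: matrix_mul_assoc)
  then have "((((**) (2 *\<^sub>R (N ** gen ** transpose N))) ^^ 2) (flow N t)) ** flow N t =
      flow N t ** ((((**) (2 *\<^sub>R (N ** gen ** transpose N))) ^^ 2) (flow N t))"
    by (simp add: numeral_2_eq_2 matrix_mul_linear_simps flow_def orthogonal_conj_mult[OF N])
  then show "((((**) (2 *\<^sub>R (N ** gen ** transpose N))) ^^ 2) (flow N t)) \<bullet> v = 0"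
    by (rule tangent_space_Gr_inner_commuting[OF flow_in_Gr[OF assms] v])
qed simp

lemma flow_piecewise_C1:
  assumes N: "orthogonal_matrix N"
  shows "flow N piecewise_C1_differentiable_on X"
proof (rule C1_differentiable_imp_piecewise)
  have "continuous_on X (flow N)"
    using has_vector_derivative_flow[OF N] has_vector_derivative_continuous
    by (metis continuous_on_eq_continuous_within)
  then have "continuous_on X (\<lambda>t. (2 *\<^sub>R (N ** gen ** transpose N)) ** flow N t)"
    by (rule bounded_linear.continuous_on[rotated])
      (simp add: linear_matrix_mul_left flip: linear_conv_bounded_linear)
  then show "flow N C1_differentiable_on X"
    unfolding C1_differentiable_on_def by (auto intro!: exI has_vector_derivative_flow[OF N])
qed

text \<open>The velocity is twice a conjugate of \<open>gen\<close> times the orthogonal matrix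
  \<open>flow N t\<close>, so the speed is constant.\<close>

lemma flow_curve_length:
  assumes N: "orthogonal_matrix N" and tr: "trace sig = 2 * real k - real CARD('n)"
  shows "curve_length Gr_metric 0 1 (flow N) = ennreal (2 * norm gen)"
proof -
  have "sqrt (Gr_metric (flow N t) v v) = 2 * norm gen"
    if t: "t \<in> {0..1}" and v: "v = vector_derivative (flow N) (at t within {0..1})" for t v
  proof -
    let ?v = "(2 *\<^sub>R (N ** gen ** transpose N)) ** flow N t"
    have "v = ?v"
      unfolding v using t
      by (intro vector_derivative_within_closed_interval has_vector_derivative_flow[OF N]) auto
    moreover have "transpose ?v = ?v"
      by (rule symmetric_vector_derivative[OF has_vector_derivative_flow[OF N] open_UNIV])
        (auto intro: GrD flow_in_Gr[OF assms])
    moreover have "orthogonal_matrix (flow N t)"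
      using flow_in_Gr[OF assms] by (simp add: Gr_def)
    ultimately show ?thesis
      by (simp add: Gr_metric_symmetric real_sqrt_mult norm_orthogonal_matrix_mul_right norm_orthogonal_conj[OF N])
  qed
  then have "curve_length Gr_metric 0 1 (flow N) =
      (\<integral>\<^sup>+t. ennreal (2 * norm gen) * indicator {0..1::real} t \<partial>lborel)"
    unfolding curve_length_def Let_def
    by (intro nn_integral_cong) (auto simp: indicator_def)
  then show ?thesis
    by (simp add: nn_integral_cmult_indicator)
qed

end

text \<open>The inner products are some of the coordinates of \<open>x\<close> in the orthonormal
  basis of columns of \<open>N\<close>.\<close>

lemma bessel_orthogonal:
  fixes N :: "real^'n::finite^'n" and f :: "'k::finite \<Rightarrow> 'n"
  assumes N: "orthogonal_matrix N" and f: "inj f"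
  shows "bessel (\<lambda>i. N *v axis (f i) 1)"
  unfolding bessel_def
proof
  fix x
  have "(\<Sum>i\<in>UNIV. (x \<bullet> (N *v axis (f i) 1))\<^sup>2) = (\<Sum>i\<in>UNIV. ((x v* N) $ f i)\<^sup>2)"
    by (simp add: inner_axis flip: dot_lmul_matrix)
  also have "\<dots> = (\<Sum>j\<in>range f. ((x v* N) $ j)\<^sup>2)"
    using f by (simp add: sum.reindex)
  also have "\<dots> \<le> (\<Sum>j\<in>UNIV. ((x v* N) $ j)\<^sup>2)"
    by (intro sum_mono2) auto
  also have "\<dots> = (norm (x v* N))\<^sup>2"
    by (simp add: norm_vec_def L2_set_def sum_nonneg)
  also have "\<dots> = x \<bullet> ((N ** transpose N) *v x)"
    by (simp add: power2_norm_eq_inner dot_lmul_matrix flip: matrix_vector_mul_assoc)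
  also have "\<dots> = (norm x)\<^sup>2"
    by (simp add: orthogonal_matrixD[OF N] power2_norm_eq_inner)
  finally show "(\<Sum>i\<in>UNIV. (x \<bullet> (N *v axis (f i) 1))\<^sup>2) \<le> (norm x)\<^sup>2" .
qed

subsection \<open>The geodesic in block form\<close>

lemma block_matrix_mul:
  fixes A :: "real^'c1::finite^'r1::finite" and B :: "real^'c2::finite^'r1"
    and C :: "real^'c1^'r2::finite" and D :: "real^'c2^'r2"
    and A' :: "real^'d1::finite^'c1" and B' :: "real^'d2::finite^'c1"
    and C' :: "real^'d1^'c2" and D' :: "real^'d2^'c2"
  shows "block_matrix A B C D ** block_matrix A' B' C' D' =
    block_matrix (A ** A' + B ** C') (A ** B' + B ** D') (C ** A' + D ** C') (C ** B' + D ** D')"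
proof -
  have "(\<Sum>x\<in>UNIV. f x) = (\<Sum>i\<in>UNIV. f (Inl i)) + (\<Sum>j\<in>UNIV. f (Inr j))"
    for f :: "'c1 + 'c2 \<Rightarrow> real"
    by (simp add: sum.Plus flip: UNIV_Plus_UNIV)
  then show ?thesis
    by (simp add: vec_eq_iff block_matrix_def matrix_matrix_mult_def split: sum.split)
qed

lemma transpose_block_matrix:
  "transpose (block_matrix A B C D) = block_matrix (transpose A) (transpose C) (transpose B) (transpose D)"
  by (simp add: vec_eq_iff block_matrix_def transpose_def split: sum.split)

lemma transpose_0: "transpose (0 :: real^'n^'m) = 0"
  by (simp add: transpose_def vec_eq_iff)

lemma mat_1_block_matrix: "mat 1 = block_matrix (mat 1) 0 0 (mat 1)"
  by (simp add: vec_eq_iff block_matrix_def mat_def split: sum.split)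

lemma scaleR_block_matrix:
  "c *\<^sub>R block_matrix A B C D = block_matrix (c *\<^sub>R A) (c *\<^sub>R B) (c *\<^sub>R C) (c *\<^sub>R D)"
  by (simp add: vec_eq_iff block_matrix_def split: sum.split)

lemma orthogonal_block_matrix:
  fixes U :: "real^'k::finite^'k" and V :: "real^'p::finite^'p"
  assumes "orthogonal_matrix U" "orthogonal_matrix V"
  shows "orthogonal_matrix (block_matrix U 0 0 V)"
  by (simp add: orthogonal_matrix transpose_block_matrix transpose_0 block_matrix_mul
      orthogonal_matrixD[OF assms(1)] orthogonal_matrixD[OF assms(2)] mat_1_block_matrix)

text \<open>The coordinates \<open>Inl i\<close> and \<open>Inr (e i)\<close> span the plane of the
  \<open>i\<close>-th principal angle. Fixed points are the remaining indices, those of the identity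
  block in the CS decomposition.\<close>

definition mate :: "('k \<Rightarrow> 'p) \<Rightarrow> 'k + 'p \<Rightarrow> 'k + 'p" where
  "mate e a = (case a of Inl i \<Rightarrow> Inr (e i) | Inr j \<Rightarrow> if j \<in> range e then Inl (inv e j) else Inr j)"

definition block_sign :: "'k + 'p \<Rightarrow> real" where
  "block_sign a = (case a of Inl _ \<Rightarrow> 1 | Inr _ \<Rightarrow> -1)"

definition pair_angle :: "('k \<Rightarrow> 'p) \<Rightarrow> ('k \<Rightarrow> real) \<Rightarrow> 'k + 'p \<Rightarrow> real" where
  "pair_angle e \<theta> a = (case a of Inl i \<Rightarrow> \<theta> i | Inr j \<Rightarrow> if j \<in> range e then \<theta> (inv e j) else 0)"

lemmas pair_defs = mate_def block_sign_def pair_angle_def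

locale principal_angles =
  fixes e :: "'k::finite \<Rightarrow> 'p::finite" and \<theta> :: "'k \<Rightarrow> real"
  assumes e: "inj e"
begin

sublocale plane_rotations "mate e" block_sign "pair_angle e \<theta>"
  by unfold_locales (use e in \<open>auto simp: pair_defs split: sum.splits dest: injD\<close>)

lemma sig_matrix_eq_sig: "sig_matrix = sig"
  by (auto simp: sig_matrix_def sig_def pair_matrix_def block_matrix_def vec_eq_iff mat_def block_sign_def
      split: sum.splits)

lemma diag_matrix_nth: "diag_matrix c $ i $ j = (if i = j then c i else 0)"
  by (simp add: diag_matrix_def)

lemma hpad_diag: "hpad e (diag_matrix c) $ i $ j = (if j = e i then c i else 0)"
  using e by (auto simp: hpad_def diag_matrix_def)

lemma vpad_diag: "vpad e (- diag_matrix c) $ i $ j = (if i = e j then - c j else 0)"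
  using e by (auto simp: vpad_def diag_matrix_def)

lemma dpad_diag:
  "dpad e (diag_matrix c) $ i $ j = (if i = j then if i \<in> range e then c (inv e i) else 1 else 0)"
  using e by (auto simp: dpad_def diag_matrix_def)

text \<open>At \<open>t = 1\<close> this is the middle factor of the CS decomposition. The signs of
  the sines come from \<open>block_sign\<close>, and the identity block is \<open>cos 0\<close> at
  the fixed points.\<close>

lemma CS_factor_eq_rot:
  "block_matrix (diag_matrix (\<lambda>i. cos (t * \<theta> i))) (hpad e (diag_matrix (\<lambda>i. sin (t * \<theta> i))))
     (vpad e (- diag_matrix (\<lambda>i. sin (t * \<theta> i)))) (dpad e (diag_matrix (\<lambda>i. cos (t * \<theta> i)))) = rot t"
  using e
  by (auto simp: block_matrix_def rot_def pair_matrix_def vec_eq_iff hpad_diag vpad_diag dpad_diag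
      diag_matrix_nth pair_defs split: sum.splits)

lemma gen_block: "gen = block_matrix 0 (hpad e (diag_matrix \<theta>)) (- transpose (hpad e (diag_matrix \<theta>))) 0"
  using e
  by (auto simp: block_matrix_def gen_def pair_matrix_def vec_eq_iff hpad_diag pair_defs
      transpose_def split: sum.splits)

lemma trace_sig: "trace sig = 2 * real CARD('k) - real CARD('k + 'p)"
proof -
  have "trace sig = (\<Sum>a\<in>UNIV. block_sign (a :: 'k + 'p))"
    by (simp add: trace_def sig_def pair_matrix_def)
  also have "\<dots> = real CARD('k) - real CARD('p)"
    by (simp add: sum.Plus block_sign_def flip: UNIV_Plus_UNIV)
  finally show ?thesis by (simp add: card_UNIV_sum)
qed

text \<open>Each angle occurs twice in \<open>gen\<close>, once for either partner. The result
  matches the general lower bound for the length.\<close>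

lemma norm_gen_angles: "2 * norm gen = sqrt 8 * sqrt (\<Sum>i\<in>UNIV. (\<theta> i)\<^sup>2)"
proof -
  have "(\<Sum>j\<in>UNIV. (pair_angle e \<theta> (Inr j))\<^sup>2) = (\<Sum>j\<in>range e. (pair_angle e \<theta> (Inr j))\<^sup>2)"
    by (rule sum.mono_neutral_right) (auto simp: pair_angle_def)
  also have "\<dots> = (\<Sum>i\<in>UNIV. (\<theta> i)\<^sup>2)"
    using e by (simp add: sum.reindex pair_angle_def)
  finally have "(norm gen)\<^sup>2 = 2 * (\<Sum>i\<in>UNIV. (\<theta> i)\<^sup>2)"
    by (simp add: norm_gen sum.Plus pair_angle_def[of _ _ "Inl _"] flip: UNIV_Plus_UNIV)
  then have "(2 * norm gen)\<^sup>2 = (sqrt 8 * sqrt (\<Sum>i\<in>UNIV. (\<theta> i)\<^sup>2))\<^sup>2"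
    by (simp add: power_mult_distrib sum_nonneg)
  then show ?thesis
    by (rule power2_eq_imp_eq) (simp_all add: sum_nonneg)
qed

lemma flow_length_minimizing:
  assumes N: "orthogonal_matrix N" and \<theta>: "\<And>i. 0 \<le> \<theta> i \<and> \<theta> i \<le> pi / 2"
  shows "length_minimizing_on (Gr CARD('k)) Gr_metric 0 1 (flow N)"
  unfolding length_minimizing_on_def
proof (intro conjI allI impI)
  show "flow N piecewise_C1_differentiable_on {0..1}"
    by (rule flow_piecewise_C1[OF N])
  show "flow N ` {0..1} \<subseteq> Gr CARD('k)"
    using flow_in_Gr[OF N trace_sig] by auto
  fix a b d
  assume "a < b \<and> d piecewise_C1_differentiable_on {a..b} \<and> d ` {a..b} \<subseteq> Gr CARD('k) \<and>
    d a = flow N 0 \<and> d b = flow N 1"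
  then have d: "a < b" "d piecewise_C1_differentiable_on {a..b}" "d ` {a..b} \<subseteq> Gr CARD('k)"
    "d a = flow N 0" "d b = flow N 1" by auto
  \<comment> \<open>The frame to be transported: the columns of \<open>N\<close> in the first block,
    an orthonormal set in the +1 eigenspace of the starting point.\<close>
  define y where "y = (\<lambda>i :: 'k. N *v axis (Inl i) 1)"
  have flow_y: "flow N t *v y i = N *v ((rot (2 * t) ** sig) *v axis (Inl i) 1)" for t i
  proof -
    have "flow N t *v y i = (N ** (rot (2 * t) ** sig) ** (transpose N ** N)) *v axis (Inl i) 1"
      unfolding flow_def y_def matrix_vector_mul_assoc by (simp only: matrix_mul_assoc)
    then show ?thesis
      by (simp add: orthogonal_matrixD[OF N] matrix_vector_mul_assoc)
  qed
  have norm_N: "norm (N *v x) = norm x" for x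
    using N by (simp add: orthogonal_transformation_norm orthogonal_transformation_matrix)
  have fixed: "d a *v y i = y i" for i
  proof -
    have "sig *v axis (Inl i) 1 = axis (Inl i) 1"
      unfolding matrix_vector_mult_basis
      by (auto simp: sig_def pair_matrix_def vec_eq_iff column_def axis_def block_sign_def)
    then show ?thesis using flow_y[of 0 i] by (simp add: d(4) rot_0 y_def)
  qed
  have "norm (eigenproj (d b) (y i)) \<le> cos (\<theta> i)" for i
  proof -
    define u where "u = (axis (Inl i) 1 :: real^('k + 'p))"
    define G where "G = rot 2 ** sig"
    have "G $ Inl i $ Inl i = cos (2 * \<theta> i)"
      by (simp add: G_def rot_def pair_matrix_mult sig_def pair_matrix_mult_nth)
        (simp add: pair_matrix_def pair_defs)
    then have uGu: "u \<bullet> (G *v u) = cos (2 * \<theta> i)"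
      by (simp add: u_def inner_axis' matrix_vector_mul_component inner_axis)
    have uu: "u \<bullet> u = 1" by (simp add: u_def inner_axis_axis)
    have "(G *v u) \<bullet> (G *v u) = (u v* G) \<bullet> (G *v u)"
      by (metis G_def transpose_rot_sig transpose_matrix_vector)
    also have "\<dots> = u \<bullet> ((G ** G) *v u)"
      by (simp add: dot_lmul_matrix matrix_vector_mul_assoc)
    finally have GG: "(G *v u) \<bullet> (G *v u) = 1"
      by (simp add: G_def rot_sig_rot_sig uu)
    have "eigenproj (d b) (y i) = N *v ((1 / 2) *\<^sub>R (u + G *v u))"
      using flow_y[of 1 i]
      by (simp add: eigenproj_def d(5) G_def u_def y_def matrix_vector_right_distrib
          matrix_vector_mult_scaleR)
    \<comment> \<open>Two unit vectors at angle \<open>2 * \<theta> i\<close> have a midpoint of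
      norm \<open>cos (\<theta> i)\<close>, by the half-angle formula.\<close>
    then have "(norm (eigenproj (d b) (y i)))\<^sup>2 = (u + G *v u) \<bullet> (u + G *v u) / 4"
      by (simp add: norm_N power_divide power2_norm_eq_inner)
    also have "\<dots> = (cos (\<theta> i))\<^sup>2"
      by (simp add: inner_add_left inner_add_right uu GG uGu inner_commute[of "G *v u" u] cos_double_cos)
    finally have "(norm (eigenproj (d b) (y i)))\<^sup>2 \<le> (cos (\<theta> i))\<^sup>2" by simp
    moreover have "0 \<le> cos (\<theta> i)"
      using \<theta>[of i] pi_ge_zero by (intro cos_ge_zero) linarith+
    ultimately show ?thesis by (rule power2_le_imp_le)
  qed
  moreover have "bessel y"
    unfolding y_def using bessel_orthogonal[OF N, of Inl] by (simp add: inj_def)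
  moreover have "norm (y i) = 1" for i
    by (simp add: y_def norm_N norm_eq_sqrt_inner[of "axis _ _"] inner_axis_axis)
  ultimately show "curve_length Gr_metric 0 1 (flow N) \<le> curve_length Gr_metric a b d"
    unfolding flow_curve_length[OF N trace_sig] norm_gen_angles
    by (intro Gr_curve_length_ge[where y = y, OF d(1-3)] fixed \<theta>)
qed

end

theorem proposition4p5:
  fixes Q0 Q1 V0 V1 :: "real^('k::finite + 'p::finite)^('k + 'p)"
    and U W :: "real^'k^'k" and V Z :: "real^'p^'p"
    and B :: "real^'p^'k"
    and \<theta> :: "'k \<Rightarrow> real"
    and e :: "'k \<Rightarrow> 'p"
    and \<gamma> :: "real \<Rightarrow> real^('k + 'p)^('k + 'p)"
  assumes e: "inj e"
    and Q0: "Q0 \<in> Gr CARD('k)" and Q1: "Q1 \<in> Gr CARD('k)"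
    and V0: "orthogonal_matrix V0" and V1: "orthogonal_matrix V1"
    and eig0: "Q0 = V0 ** sig_matrix ** transpose V0"
    and eig1: "Q1 = V1 ** sig_matrix ** transpose V1"
    and U: "orthogonal_matrix U" and W: "orthogonal_matrix W"
    and V: "orthogonal_matrix V" and Z: "orthogonal_matrix Z"
    and \<theta>: "\<And>i. 0 \<le> \<theta> i \<and> \<theta> i \<le> pi / 2"
    and CS: "transpose V0 ** V1 =
      block_matrix U 0 0 V **
      block_matrix
        (diag_matrix (\<lambda>i. cos (\<theta> i)))               (hpad e (diag_matrix (\<lambda>i. sin (\<theta> i))))
        (vpad e (- diag_matrix (\<lambda>i. sin (\<theta> i))))    (dpad e (diag_matrix (\<lambda>i. cos (\<theta> i)))) **
      transpose (block_matrix W 0 0 Z)"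
    and B: "B = - (2 *\<^sub>R (U ** hpad e (diag_matrix \<theta>) ** transpose V))"
    and \<gamma>: "\<And>t. \<gamma> t =
      V0 ** matrix_exp ((t / 2) *\<^sub>R block_matrix 0 (- B) (transpose B) 0) ** sig_matrix **
      matrix_exp ((t / 2) *\<^sub>R block_matrix 0 B (- transpose B) 0) ** transpose V0"
  shows "geodesic_on (Gr CARD('k)) 0 1 \<gamma> \<and>
         length_minimizing_on (Gr CARD('k)) Gr_metric 0 1 \<gamma> \<and>
         \<gamma> 0 = Q0 \<and> \<gamma> 1 = Q1"
proof -
  interpret principal_angles e \<theta> by unfold_locales (rule e)
  define D where "D = block_matrix U 0 0 V"
  define D' where "D' = block_matrix W 0 0 Z"
  have D: "orthogonal_matrix D" and D': "orthogonal_matrix D'"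
    by (simp_all add: D_def D'_def orthogonal_block_matrix U V W Z)
  define N where "N = V0 ** D"
  have N: "orthogonal_matrix N"
    unfolding N_def by (rule orthogonal_matrix_mul[OF V0 D])
  \<comment> \<open>Block diagonal orthogonal matrices commute with the signature matrix, so
    \<open>U\<close>, \<open>V\<close>, \<open>W\<close> and \<open>Z\<close> drop out of the end
    points.\<close>
  have D_sig: "transpose D ** sig ** D = sig" "D ** sig ** transpose D = sig"
    "transpose D' ** sig ** D' = sig"
    by (simp_all add: D_def D'_def block_matrix_mul transpose_block_matrix transpose_0 matrix_mul_linear_simps
        orthogonal_matrixD[OF U] orthogonal_matrixD[OF V] orthogonal_matrixD[OF W]
        orthogonal_matrixD[OF Z] sig_matrix_def flip: sig_matrix_eq_sig)
  \<comment> \<open>The factor -2 in \<open>B\<close> cancels against the 1/2 in the exponents: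
    these become \<open>t\<close> and \<open>- t\<close> times this conjugate of
    \<open>gen\<close>.\<close>
  have gen_D: "D ** gen ** transpose D = block_matrix 0 (- ((1 / 2) *\<^sub>R B)) ((1 / 2) *\<^sub>R transpose B) 0"
    by (simp add: transpose_0 D_def gen_block B block_matrix_mul transpose_block_matrix matrix_mul_linear_simps
        transpose_linear_simps matrix_transpose_mul matrix_mul_assoc)
  have exp: "matrix_exp (t *\<^sub>R (D ** gen ** transpose D)) = D ** rot t ** transpose D" for t
    using matrix_exp_conj[OF D matrix_exp_sums_rot] by (simp add: matrix_mul_linear_simps)
  have exp1: "matrix_exp ((t / 2) *\<^sub>R block_matrix 0 (- B) (transpose B) 0) = D ** rot t ** transpose D"
    for t
    unfolding exp[symmetric] gen_D by (simp add: scaleR_block_matrix)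
  have exp2: "matrix_exp ((t / 2) *\<^sub>R block_matrix 0 B (- transpose B) 0) = D ** rot (- t) ** transpose D"
    for t
    unfolding exp[symmetric] gen_D by (simp add: scaleR_block_matrix)
  have flow_eq: "N ** rot t ** sig ** rot (- t) ** transpose N = flow N t" for t
    by (simp add: flow_def matrix_mul_assoc flip: rot_sig_rot)
  have gamma_flow: "\<gamma> = flow N"
  proof
    fix t
    have "\<gamma> t = V0 ** D ** rot t ** (transpose D ** sig ** D) ** rot (- t) ** transpose (V0 ** D)"
      unfolding \<gamma> exp1 exp2 sig_matrix_eq_sig matrix_transpose_mul by (simp only: matrix_mul_assoc)
    then show "\<gamma> t = flow N t"
      unfolding D_sig by (simp add: flow_eq flip: N_def)
  qed
  have "\<gamma> 0 = V0 ** (D ** sig ** transpose D) ** transpose V0"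
    unfolding gamma_flow flow_def N_def matrix_transpose_mul by (simp add: rot_0 matrix_mul_assoc)
  then have g0: "\<gamma> 0 = Q0"
    unfolding D_sig eig0 sig_matrix_eq_sig .
  have CS': "transpose V0 ** V1 = D ** rot 1 ** transpose D'"
    using CS CS_factor_eq_rot[of 1] by (simp add: D_def D'_def)
  have "V1 = V0 ** (transpose V0 ** V1)"
    by (simp add: matrix_mul_assoc orthogonal_matrixD[OF V0])
  \<comment> \<open>Only \<open>transpose D'\<close> separates \<open>V1\<close> from
    \<open>N ** rot 1\<close>, and it cancels in \<open>Q1\<close> because it commutes with
    \<open>sig\<close>.\<close>
  then have V1_eq: "V1 = N ** rot 1 ** transpose D'"
    unfolding CS' N_def by (simp only: matrix_mul_assoc)
  have "Q1 = N ** rot 1 ** (transpose D' ** sig ** D') ** transpose (rot 1) ** transpose N"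
    unfolding eig1 V1_eq sig_matrix_eq_sig matrix_transpose_mul transpose_transpose
    by (simp only: matrix_mul_assoc)
  then have g1: "\<gamma> 1 = Q1"
    unfolding D_sig gamma_flow by (simp add: transpose_rot flow_eq)
  show ?thesis
    using flow_geodesic[OF N trace_sig] flow_length_minimizing[OF N \<theta>] g0 g1
    unfolding gamma_flow by blast
qed

end
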